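(* Consider a multicriteria minimization problem $\min_{x\in\mathcal{X}}Cx$ with set of feasible solutions $\mathcal{X}\subseteq\{0,1\}^n$ and cost matrix $C\in\mathbb{Z}^{k\times n}_{\ge0}$, and let $p\in[1,\infty]$. Suppose that 1. for any instance $I=(\mathcal{X},C)$ and any feasible reference point $\bar y$, a lower bound $L$ and an upper bound $U$ on $\min_{x\in\mathcal{X}}r(Cx)$ can be computed in time $\pi_1(|I|)$ such that $U\le\pi_2(|I|)L$, where $\pi_1,\pi_2$ are non-decreasing polynomials, and 2. there is an algorithm that solves $\min_{x\in\mathcal{X}}r(Cx)$ for any instance $I=(\mathcal{X},C)$ in time $\pi_3(|I|,U)$, where $\pi_3$ is a non-decreasing polynomial. Then there is an FPTAS for $\min_{x\in\mathcal{X}}r(Cx)$, where $r(y)=\|\bar y\|_{[p]}+\|y-\bar y\|_{[p]}$.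
   Context: $|I|$ denotes the encoding length of the instance $I$. The ideal point is $y^{\mathrm{id}}_i=\min_{x\in\mathcal{X}}(Cx)_i$; a feasible reference point is $\bar y\in\mathbb{Z}^k_{\ge0}$ with $\bar y\le y^{\mathrm{id}}$ componentwise. The cornered $p$-norm is $\|y\|_{[p]}=\max_i|y_i|+\frac1p\sum_i|y_i|$ for $p\ge1$, and $\|y\|_{[\infty]}=\max_i|y_i|$. An FPTAS is a family of algorithms containing, for every $\epsilon>0$, an algorithm returning $x\in\mathcal{X}$ with $r(Cx)\le(1+\epsilon)\min_{z\in\mathcal{X}}r(Cz)$ in time polynomial in $|I|$ and $1/\epsilon$. *)

theory Defs
  imports
    "HOL-Library.Discrete_Functions"
    "HOL-Library.Extended_Real"
    "HOL-Computational_Algebra.Polynomial"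
    "Jordan_Normal_Form.Matrix"
begin

section \<open>Model of computation\<close>

text \<open>
  Algorithms are programs of a small combinator language over binary trees whose leaves are
  natural numbers. Running time is measured by the logarithmic cost criterion: every elementary
  operation, including arithmetic, is charged the binary length of the data it reads and writes
  (as for the logarithmic-cost RAM of Aho, Hopcroft and Ullman). The model is
  Turing complete, and its polynomial-time computable functions are those of Turing machines:
  an elementary operation is computable in time polynomial in its charge, and conversely
  a Turing machine configuration is a pair of lists of symbols, updated at linear cost.
\<close>

datatype data = Num nat | Pair data data

fun bit_size :: "data \<Rightarrow> nat" where
  "bit_size (Num m) = floor_log m + 1"
| "bit_size (Pair a b) = 1 + bit_size a + bit_size b"

datatype elem_op = Id | Const data | Fst | Snd | IsPair | Add | Sub | Mul | Div

text \<open>Ill-typed applications return \<open>0\<close>; subtraction is truncated and division rounds down.\<close>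

fun elem_val :: "elem_op \<Rightarrow> data \<Rightarrow> data" where
  "elem_val Id x = x"
| "elem_val (Const c) x = c"
| "elem_val Fst (Pair a b) = a"
| "elem_val Snd (Pair a b) = b"
| "elem_val IsPair (Pair a b) = Num 1"
| "elem_val Add (Pair (Num a) (Num b)) = Num (a + b)"
| "elem_val Sub (Pair (Num a) (Num b)) = Num (a - b)"
| "elem_val Mul (Pair (Num a) (Num b)) = Num (a * b)"
| "elem_val Div (Pair (Num a) (Num b)) = Num (a div b)"
| "elem_val _ _ = Num 0"

datatype prog =
    Elem elem_op
  | Fork prog prog
  | Seq prog prog
  | If prog prog prog
  | While prog prog

text \<open>
  \<open>exec A x y t\<close>: program \<open>A\<close>, started on input \<open>x\<close>, halts with output \<open>y\<close> after time \<open>t\<close>.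
  A test succeeds if its value is not \<open>Num 0\<close>.
\<close>

inductive exec :: "prog \<Rightarrow> data \<Rightarrow> data \<Rightarrow> nat \<Rightarrow> bool" where
  Elem: "exec (Elem f) x (elem_val f x) (bit_size x + bit_size (elem_val f x))"
| Fork: "exec A x a s \<Longrightarrow> exec B x b t \<Longrightarrow> exec (Fork A B) x (Pair a b) (1 + bit_size x + s + t)"
| Seq: "exec A x y s \<Longrightarrow> exec B y z t \<Longrightarrow> exec (Seq A B) x z (1 + s + t)"
| If_true: "exec T x c s \<Longrightarrow> c \<noteq> Num 0 \<Longrightarrow> exec A x y t \<Longrightarrow>
    exec (If T A B) x y (1 + bit_size x + s + t)"
| If_false: "exec T x (Num 0) s \<Longrightarrow> exec B x y t \<Longrightarrow>
    exec (If T A B) x y (1 + bit_size x + s + t)"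
| While_stop: "exec T x (Num 0) s \<Longrightarrow> exec (While T A) x x (1 + bit_size x + s)"
| While_step: "exec T x c s \<Longrightarrow> c \<noteq> Num 0 \<Longrightarrow> exec A x y t \<Longrightarrow> exec (While T A) y z u \<Longrightarrow>
    exec (While T A) x z (1 + bit_size x + s + t + u)"

lemma exec_deterministic:
  "exec A x y s \<Longrightarrow> exec A x z t \<Longrightarrow> z = y \<and> t = s"
proof (induction arbitrary: z t rule: exec.induct)
  case (Elem f x)
  then show ?case by cases auto
next
  case (Fork A x a s B b t)
  from Fork.prems show ?case by cases (use Fork.IH in blast)+
next
  case (Seq A x y s B z t)
  from Seq.prems show ?case by cases (use Seq.IH in blast)+
next
  case (If_true T x c s A y t B)
  from If_true.prems show ?case by cases (use If_true.IH If_true.hyps in blast)+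
next
  case (If_false T x s B y t A)
  from If_false.prems show ?case by cases (use If_false.IH If_false.hyps in blast)+
next
  case (While_stop T x s A)
  from While_stop.prems show ?case by cases (use While_stop.IH While_stop.hyps in blast)+
next
  case (While_step T x c s A y t z u)
  from While_step.prems show ?case by cases (use While_step.IH While_step.hyps in blast)+
qed

lemma exec_output_bit_size: "exec A x y t \<Longrightarrow> bit_size y \<le> t"
  by (induction rule: exec.induct) auto

definition runs_within :: "prog \<Rightarrow> data \<Rightarrow> data \<Rightarrow> real \<Rightarrow> bool" where
  "runs_within A x y b \<longleftrightarrow> (\<exists>t. exec A x y t \<and> real t \<le> b)"


section \<open>Encodings\<close>

fun enc_list :: "data list \<Rightarrow> data" where
  "enc_list [] = Num 0"
| "enc_list (a # as) = Pair a (enc_list as)"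

definition enc_vec :: "nat vec \<Rightarrow> data" where
  "enc_vec v = enc_list (map Num (list_of_vec v))"

definition enc_mat :: "nat mat \<Rightarrow> data" where
  "enc_mat M = enc_list (map (\<lambda>row. enc_list (map Num row)) (mat_to_list M))"

definition represents :: "data \<Rightarrow> real \<Rightarrow> bool" where
  "represents d q \<longleftrightarrow> (\<exists>a b. d = Pair (Num a) (Num b) \<and> b > 0 \<and> q = real a / real b)"


section \<open>Multicriteria minimization problems\<close>

text \<open>
  The feasible set of an instance is given implicitly (by a graph, say). A problem therefore
  consists of a set of descriptions \<open>s\<close>, each determining the dimensions \<open>n = num_vars P s\<close>
  and \<open>k = num_crit P s\<close> and the set of feasible solutions \<open>feasible P s\<close>; a problem with
  a fixed number of criteria is one where \<open>num_crit P\<close> is constant. An instance consists of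
  a description and an arbitrary nonnegative integral cost matrix of matching dimensions.
\<close>

record mc_problem =
  descriptions :: "data set"
  num_vars :: "data \<Rightarrow> nat"
  num_crit :: "data \<Rightarrow> nat"
  feasible :: "data \<Rightarrow> nat vec set"

definition multicriteria_problem :: "mc_problem \<Rightarrow> bool" where
  "multicriteria_problem P \<longleftrightarrow> (\<forall>s\<in>descriptions P.
     num_crit P s \<ge> 1 \<and> feasible P s \<noteq> {} \<and>
     feasible P s \<subseteq> {x \<in> carrier_vec (num_vars P s). \<forall>j<num_vars P s. x $ j \<in> {0, 1}})"

type_synonym mc_instance = "data \<times> nat mat"

definition instances :: "mc_problem \<Rightarrow> mc_instance set" where
  "instances P = {(s, C). s \<in> descriptions P \<and> C \<in> carrier_mat (num_crit P s) (num_vars P s)}"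

definition solutions :: "mc_problem \<Rightarrow> mc_instance \<Rightarrow> nat vec set" where
  "solutions P I = feasible P (fst I)"

definition cost :: "mc_instance \<Rightarrow> nat vec \<Rightarrow> nat vec" where
  "cost I x = snd I *\<^sub>v x"

definition enc_instance :: "mc_instance \<Rightarrow> data" where
  "enc_instance I = Pair (fst I) (enc_mat (snd I))"

definition enc_input :: "mc_instance \<Rightarrow> nat vec \<Rightarrow> data" where
  "enc_input I ybar = Pair (enc_instance I) (enc_vec ybar)"

definition encoding_length :: "mc_instance \<Rightarrow> real" where
  "encoding_length I = real (bit_size (enc_instance I))"

definition ideal_point :: "mc_problem \<Rightarrow> mc_instance \<Rightarrow> nat vec" where
  "ideal_point P I = vec (num_crit P (fst I)) (\<lambda>i. Min ((\<lambda>x. cost I x $ i) ` solutions P I))"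

definition reference_points :: "mc_problem \<Rightarrow> mc_instance \<Rightarrow> nat vec set" where
  "reference_points P I = {ybar \<in> carrier_vec (num_crit P (fst I)).
     \<forall>i<num_crit P (fst I). ybar $ i \<le> ideal_point P I $ i}"

definition cornered_norm :: "ereal \<Rightarrow> real vec \<Rightarrow> real" where
  "cornered_norm p y =
     (if p = \<infinity> then Max ((\<lambda>i. \<bar>y $ i\<bar>) ` {..<dim_vec y})
      else Max ((\<lambda>i. \<bar>y $ i\<bar>) ` {..<dim_vec y})
           + 1 / real_of_ereal p * (\<Sum>i<dim_vec y. \<bar>y $ i\<bar>))"

definition ref_obj :: "ereal \<Rightarrow> nat vec \<Rightarrow> nat vec \<Rightarrow> real" where
  "ref_obj p ybar y =
     cornered_norm p (map_vec real ybar) + cornered_norm p (map_vec real y - map_vec real ybar)"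

definition opt_val :: "mc_problem \<Rightarrow> ereal \<Rightarrow> mc_instance \<Rightarrow> nat vec \<Rightarrow> real" where
  "opt_val P p I ybar = Min ((\<lambda>x. ref_obj p ybar (cost I x)) ` solutions P I)"


section \<open>Bivariate polynomials and approximation schemes\<close>

definition poly2 :: "real poly poly \<Rightarrow> real \<Rightarrow> real \<Rightarrow> real" where
  "poly2 q x y = poly (poly q [:y:]) x"

definition nondecreasing :: "real poly \<Rightarrow> bool" where
  "nondecreasing q \<longleftrightarrow> mono_on {0..} (poly q)"

definition nondecreasing2 :: "real poly poly \<Rightarrow> bool" where
  "nondecreasing2 q \<longleftrightarrow>
     (\<forall>x x' y y'. 0 \<le> x \<and> x \<le> x' \<and> 0 \<le> y \<and> y \<le> y' \<longrightarrow> poly2 q x y \<le> poly2 q x' y')"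

definition has_fptas :: "mc_problem \<Rightarrow> ereal \<Rightarrow> bool" where
  "has_fptas P p \<longleftrightarrow> (\<exists>q. \<forall>\<epsilon>>0. \<exists>A. \<forall>I\<in>instances P. \<forall>ybar\<in>reference_points P I.
     \<exists>x\<in>solutions P I.
       runs_within A (enc_input I ybar) (enc_vec x) (poly2 q (encoding_length I) (1 / \<epsilon>)) \<and>
       ref_obj p ybar (cost I x) \<le> (1 + \<epsilon>) * opt_val P p I ybar)"

end

theory Submission
  imports Defs
begin

text \<open>
  Let \<open>L\<close> be the lower bound and let \<open>m \<ge> 1 / \<epsilon>\<close> be an integer. If \<open>L = 0\<close>, then \<open>U = 0\<close> and the exact
  algorithm is fast on the given instance. Otherwise costs and reference point are multiplied by some
  \<open>\<rho>\<close> and rounded, the costs up and the reference point down, so that the rounded reference point stays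
  below the rounded ideal point. As the cornered norm is a norm that is at most \<open>k + 1\<close> times the
  maximum norm, the objective of each solution changes, apart from the factor \<open>\<rho>\<close>, by at most
  \<open>E = (k + 1) (n + 2)\<close>. Optimal solutions of the rounded instance are therefore optimal up to
  \<open>2 E / \<rho>\<close>, which is \<open>L / m \<le> \<epsilon> L\<close> for \<open>\<rho> = 2 m E / L\<close>. The optimal value of the rounded instance is
  at most \<open>\<rho> U + E = E (2 m U / L + 1)\<close>, which is polynomially bounded because \<open>U / L\<close> is, and so is
  the running time of the exact algorithm on it.
\<close>


section \<open>Polynomial bounds\<close>

definition poly_bounded :: "'i set \<Rightarrow> ('i \<Rightarrow> nat) \<Rightarrow> ('i \<Rightarrow> nat) \<Rightarrow> bool" where
  "poly_bounded S u v \<longleftrightarrow> (\<exists>c. \<forall>i\<in>S. v i \<le> (u i + 2) ^ c)"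

lemma poly_boundedI: "(\<And>i. i \<in> S \<Longrightarrow> v i \<le> (u i + 2) ^ c) \<Longrightarrow> poly_bounded S u v"
  unfolding poly_bounded_def by blast

lemma poly_boundedE:
  assumes "poly_bounded S u v"
  obtains c where "\<And>i. i \<in> S \<Longrightarrow> v i \<le> (u i + 2) ^ c"
  using assms unfolding poly_bounded_def by blast

lemma poly_bounded_mono:
  assumes "poly_bounded S u w" and "\<And>i. i \<in> S \<Longrightarrow> v i \<le> w i"
  shows "poly_bounded S u v"
  using assms unfolding poly_bounded_def by (meson order_trans)

lemma poly_bounded_reindex:
  assumes "poly_bounded T u v" and "h ` S \<subseteq> T"
  shows "poly_bounded S (\<lambda>i. u (h i)) (\<lambda>i. v (h i))"
  using assms unfolding poly_bounded_def by blast

lemma poly_bounded_subset: "poly_bounded T u v \<Longrightarrow> S \<subseteq> T \<Longrightarrow> poly_bounded S u v"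
  by (drule poly_bounded_reindex[where h = "\<lambda>i. i"]) auto

lemma poly_bounded_refl: "poly_bounded S u u"
  by (rule poly_boundedI[of _ _ _ 1]) simp

lemma poly_bounded_le: "(\<And>i. i \<in> S \<Longrightarrow> v i \<le> u i) \<Longrightarrow> poly_bounded S u v"
  by (rule poly_bounded_mono[OF poly_bounded_refl])

lemma poly_bounded_const: "poly_bounded S u (\<lambda>_. k)"
proof (rule poly_boundedI)
  fix i
  have "k \<le> 2 ^ k" by (simp add: less_imp_le)
  also have "\<dots> \<le> (u i + 2) ^ k" by (rule power_mono) auto
  finally show "k \<le> (u i + 2) ^ k" .
qed

lemma poly_bounded_add:
  assumes "poly_bounded S u v" and "poly_bounded S u w"
  shows "poly_bounded S u (\<lambda>i. v i + w i)"
proof -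
  obtain c where v_le: "\<And>i. i \<in> S \<Longrightarrow> v i \<le> (u i + 2) ^ c"
    using assms(1) by (rule poly_boundedE) blast
  obtain d where w_le: "\<And>i. i \<in> S \<Longrightarrow> w i \<le> (u i + 2) ^ d"
    using assms(2) by (rule poly_boundedE) blast
  show ?thesis
  proof (rule poly_boundedI)
    fix i assume i: "i \<in> S"
    have "v i + w i \<le> (u i + 2) ^ (c + d) + (u i + 2) ^ (c + d)"
      by (intro add_mono order_trans[OF v_le[OF i]] order_trans[OF w_le[OF i]] power_increasing)
        auto
    also have "\<dots> \<le> (u i + 2) ^ Suc (c + d)" by simp
    finally show "v i + w i \<le> (u i + 2) ^ Suc (c + d)" .
  qed
qed

lemma poly_bounded_mult:
  assumes "poly_bounded S u v" and "poly_bounded S u w"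
  shows "poly_bounded S u (\<lambda>i. v i * w i)"
proof -
  obtain c where v_le: "\<And>i. i \<in> S \<Longrightarrow> v i \<le> (u i + 2) ^ c"
    using assms(1) by (rule poly_boundedE) blast
  obtain d where w_le: "\<And>i. i \<in> S \<Longrightarrow> w i \<le> (u i + 2) ^ d"
    using assms(2) by (rule poly_boundedE) blast
  show ?thesis
    by (rule poly_boundedI[of _ _ _ "c + d"])
      (simp add: power_add mult_mono v_le w_le del: add_2_eq_Suc')
qed

lemma poly_bounded_power: "poly_bounded S u v \<Longrightarrow> poly_bounded S u (\<lambda>i. v i ^ c)"
  by (induction c) (auto intro: poly_bounded_const poly_bounded_mult)

lemmas poly_bounded_intros =
  poly_bounded_refl poly_bounded_const poly_bounded_add poly_bounded_mult poly_bounded_power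

lemma poly_bounded_trans:
  assumes "poly_bounded S u v" and "poly_bounded S v w"
  shows "poly_bounded S u w"
proof -
  obtain c where w_le: "\<And>i. i \<in> S \<Longrightarrow> w i \<le> (v i + 2) ^ c"
    using assms(2) by (rule poly_boundedE) blast
  have "poly_bounded S u (\<lambda>i. (v i + 2) ^ c)" by (intro poly_bounded_intros assms(1))
  then show ?thesis using w_le by (rule poly_bounded_mono)
qed

lemma poly_bounded_sum:
  fixes v :: "'i \<times> 'j \<Rightarrow> nat"
  assumes "poly_bounded (SIGMA i:S. A i) (\<lambda>ij. u (fst ij)) v"
    and "poly_bounded S u (\<lambda>i. card (A i))"
  shows "poly_bounded S u (\<lambda>i. \<Sum>j\<in>A i. v (i, j))"
proof -
  obtain c where v_le: "\<And>ij. ij \<in> (SIGMA i:S. A i) \<Longrightarrow> v ij \<le> (u (fst ij) + 2) ^ c"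
    using assms(1) by (rule poly_boundedE) blast
  have "poly_bounded S u (\<lambda>i. card (A i) * (u i + 2) ^ c)"
    by (intro poly_bounded_intros assms(2))
  then show ?thesis
  proof (rule poly_bounded_mono)
    fix i assume "i \<in> S"
    then have "v (i, j) \<le> (u i + 2) ^ c" if "j \<in> A i" for j
      using v_le[of "(i, j)"] that by simp
    then show "(\<Sum>j\<in>A i. v (i, j)) \<le> card (A i) * (u i + 2) ^ c"
      using sum_bounded_above[of "A i" "\<lambda>j. v (i, j)"] by simp
  qed
qed

lemma nat_ceiling_add_mult_le: "nat \<lceil>a + real n * r\<rceil> \<le> nat \<lceil>a\<rceil> + n * nat \<lceil>r\<rceil>"
proof -
  have "a + real n * r \<le> real (nat \<lceil>a\<rceil>) + real n * real (nat \<lceil>r\<rceil>)"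
    by (intro add_mono mult_left_mono real_nat_ceiling_ge) simp
  then show ?thesis by simp
qed

lemma poly_bounded_poly:
  assumes "poly_bounded S u v"
  shows "poly_bounded S u (\<lambda>i. nat \<lceil>poly q (real (v i))\<rceil>)"
proof (induction q)
  case 0
  show ?case by (simp add: poly_bounded_const)
next
  case (pCons a q)
  have "poly_bounded S u (\<lambda>i. nat \<lceil>a\<rceil> + v i * nat \<lceil>poly q (real (v i))\<rceil>)"
    by (intro poly_bounded_intros assms pCons.IH)
  then show ?case
    by (rule poly_bounded_mono) (simp only: poly_pCons nat_ceiling_add_mult_le)
qed

lemma poly_bounded_poly2:
  assumes "poly_bounded S u v" and "poly_bounded S u w"
  shows "poly_bounded S u (\<lambda>i. nat \<lceil>poly2 q (real (v i)) (real (w i))\<rceil>)"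
proof (induction q)
  case 0
  show ?case by (simp add: poly2_def poly_bounded_const)
next
  case (pCons a q)
  have "poly_bounded S u
      (\<lambda>i. nat \<lceil>poly a (real (v i))\<rceil> + w i * nat \<lceil>poly2 q (real (v i)) (real (w i))\<rceil>)"
    by (intro poly_bounded_intros poly_bounded_poly assms pCons.IH)
  moreover have "poly2 (pCons a q) x y = poly a x + y * poly2 q x y" for x y
    by (simp add: poly2_def)
  ultimately show ?case
    by (elim poly_bounded_mono) (simp only: nat_ceiling_add_mult_le)
qed


section \<open>Polynomial-time computability\<close>

text \<open>
  The function to be computed is given by indexed families of inputs \<open>f\<close> and outputs \<open>g\<close>, and time
  is measured in a size \<open>u\<close> of the index: hypotheses on the inputs become part of the index set, and
  composition needs no image sets.
\<close>

definition poly_time :: "'i set \<Rightarrow> ('i \<Rightarrow> nat) \<Rightarrow> ('i \<Rightarrow> data) \<Rightarrow> ('i \<Rightarrow> data) \<Rightarrow> bool" where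
  "poly_time S u f g \<longleftrightarrow> (\<exists>A \<tau>. poly_bounded S u \<tau> \<and> (\<forall>i\<in>S. exec A (f i) (g i) (\<tau> i)))"

abbreviation poly_computable :: "'i set \<Rightarrow> ('i \<Rightarrow> data) \<Rightarrow> ('i \<Rightarrow> data) \<Rightarrow> bool" where
  "poly_computable S f g \<equiv> poly_time S (\<lambda>i. bit_size (f i)) f g"

lemma poly_timeI:
  assumes "poly_bounded S u \<tau>" and "\<And>i. i \<in> S \<Longrightarrow> exec A (f i) (g i) (\<tau> i)"
  shows "poly_time S u f g"
  using assms unfolding poly_time_def by blast

lemma poly_timeE:
  assumes "poly_time S u f g"
  obtains A \<tau> where "poly_bounded S u \<tau>" and "\<And>i. i \<in> S \<Longrightarrow> exec A (f i) (g i) (\<tau> i)"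
  using assms unfolding poly_time_def by blast

lemma poly_time_cong:
  assumes "poly_time S u f g" and "\<And>i. i \<in> S \<Longrightarrow> f' i = f i" and "\<And>i. i \<in> S \<Longrightarrow> g' i = g i"
  shows "poly_time S u f' g'"
  using assms unfolding poly_time_def by simp

lemma poly_time_reindex:
  assumes "poly_time T u f g" and "h ` S \<subseteq> T"
  shows "poly_time S (\<lambda>i. u (h i)) (\<lambda>i. f (h i)) (\<lambda>i. g (h i))"
proof -
  obtain A \<tau> where time: "poly_bounded T u \<tau>"
    and run: "\<And>i. i \<in> T \<Longrightarrow> exec A (f i) (g i) (\<tau> i)"
    using assms(1) by (rule poly_timeE) blast
  show ?thesis
    using poly_bounded_reindex[OF time assms(2)] by (rule poly_timeI) (use run assms(2) in blast)
qed

lemma poly_time_subset: "poly_time T u f g \<Longrightarrow> S \<subseteq> T \<Longrightarrow> poly_time S u f g"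
  by (drule poly_time_reindex[where h = "\<lambda>i. i"]) auto

lemma poly_time_size_mono: "poly_time S v f g \<Longrightarrow> poly_bounded S u v \<Longrightarrow> poly_time S u f g"
  by (erule poly_timeE) (blast intro: poly_timeI poly_bounded_trans)

lemma exec_input_bit_size: "exec A x y t \<Longrightarrow> bit_size x \<le> t"
  by (induction rule: exec.induct) auto

lemma poly_time_bit_size_input:
  "poly_time S u f g \<Longrightarrow> poly_bounded S u (\<lambda>i. bit_size (f i))"
  by (erule poly_timeE) (blast intro: poly_bounded_mono exec_input_bit_size)

lemma poly_time_bit_size_output:
  "poly_time S u f g \<Longrightarrow> poly_bounded S u (\<lambda>i. bit_size (g i))"
  by (erule poly_timeE) (blast intro: poly_bounded_mono exec_output_bit_size)

lemma poly_time_trans: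
  assumes "poly_time S u f g" and "poly_time S u g h"
  shows "poly_time S u f h"
proof -
  obtain A \<sigma> where time_A: "poly_bounded S u \<sigma>" and run_A: "\<And>i. i \<in> S \<Longrightarrow> exec A (f i) (g i) (\<sigma> i)"
    using assms(1) by (rule poly_timeE) blast
  obtain B \<tau> where time_B: "poly_bounded S u \<tau>" and run_B: "\<And>i. i \<in> S \<Longrightarrow> exec B (g i) (h i) (\<tau> i)"
    using assms(2) by (rule poly_timeE) blast
  have "poly_bounded S u (\<lambda>i. 1 + \<sigma> i + \<tau> i)" by (intro poly_bounded_intros time_A time_B)
  then show ?thesis by (rule poly_timeI) (use run_A run_B in \<open>blast intro: exec.Seq\<close>)
qed

lemma poly_time_comp: "poly_time S u f g \<Longrightarrow> poly_computable S g h \<Longrightarrow> poly_time S u f h"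
  by (blast intro: poly_time_trans poly_time_size_mono poly_time_bit_size_output)

lemma poly_time_Pair:
  assumes "poly_time S u f g" and "poly_time S u f h"
  shows "poly_time S u f (\<lambda>i. Pair (g i) (h i))"
proof -
  obtain A \<sigma> where time_A: "poly_bounded S u \<sigma>" and run_A: "\<And>i. i \<in> S \<Longrightarrow> exec A (f i) (g i) (\<sigma> i)"
    using assms(1) by (rule poly_timeE) blast
  obtain B \<tau> where time_B: "poly_bounded S u \<tau>" and run_B: "\<And>i. i \<in> S \<Longrightarrow> exec B (f i) (h i) (\<tau> i)"
    using assms(2) by (rule poly_timeE) blast
  have "poly_bounded S u (\<lambda>i. 1 + bit_size (f i) + \<sigma> i + \<tau> i)"
    by (intro poly_bounded_intros poly_time_bit_size_input[OF assms(1)] time_A time_B)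
  then show ?thesis by (rule poly_timeI) (use run_A run_B in \<open>blast intro: exec.Fork\<close>)
qed

lemma poly_time_If:
  assumes test: "poly_time S u f t"
    and "poly_time {i \<in> S. t i \<noteq> Num 0} u f g" and "poly_time {i \<in> S. t i = Num 0} u f g"
  shows "poly_time S u f g"
proof -
  let ?S1 = "{i \<in> S. t i \<noteq> Num 0}" and ?S0 = "{i \<in> S. t i = Num 0}"
  obtain T \<rho> where time_T: "poly_bounded S u \<rho>" and run_T: "\<And>i. i \<in> S \<Longrightarrow> exec T (f i) (t i) (\<rho> i)"
    using test by (rule poly_timeE) blast
  obtain A \<sigma> where time_A: "poly_bounded ?S1 u \<sigma>"
    and run_A: "\<And>i. i \<in> ?S1 \<Longrightarrow> exec A (f i) (g i) (\<sigma> i)"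
    using assms(2) by (rule poly_timeE) blast
  obtain B \<tau> where time_B: "poly_bounded ?S0 u \<tau>"
    and run_B: "\<And>i. i \<in> ?S0 \<Longrightarrow> exec B (f i) (g i) (\<tau> i)"
    using assms(3) by (rule poly_timeE) blast
  obtain c where \<sigma>_le: "\<And>i. i \<in> ?S1 \<Longrightarrow> \<sigma> i \<le> (u i + 2) ^ c" using time_A by (rule poly_boundedE) blast
  obtain d where \<tau>_le: "\<And>i. i \<in> ?S0 \<Longrightarrow> \<tau> i \<le> (u i + 2) ^ d" using time_B by (rule poly_boundedE) blast
  let ?branch = "\<lambda>i. if t i = Num 0 then \<tau> i else \<sigma> i"
  have "poly_bounded S u (\<lambda>i. (u i + 2) ^ c + (u i + 2) ^ d)" by (intro poly_bounded_intros)
  then have "poly_bounded S u ?branch"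
    by (rule poly_bounded_mono) (use \<sigma>_le \<tau>_le in \<open>auto intro: trans_le_add1 trans_le_add2\<close>)
  then have "poly_bounded S u (\<lambda>i. 1 + bit_size (f i) + \<rho> i + ?branch i)"
    by (intro poly_bounded_intros time_T poly_time_bit_size_input[OF test])
  then show ?thesis
  proof (rule poly_timeI)
    fix i assume i: "i \<in> S"
    show "exec (If T A B) (f i) (g i) (1 + bit_size (f i) + \<rho> i + ?branch i)"
    proof (cases "t i = Num 0")
      case True
      then show ?thesis using exec.If_false[OF _ run_B] run_T[OF i] i by simp
    next
      case False
      then show ?thesis using exec.If_true[OF run_T[OF i] False run_A] i by simp
    qed
  qed
qed

lemma floor_log_add_le: "floor_log (a + b) \<le> floor_log a + floor_log b + 1"
proof -
  have "floor_log (a + b) \<le> floor_log (2 * max a b)"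
    by (rule floor_log_le_iff) auto
  also have "\<dots> \<le> Suc (floor_log (max a b))"
    by (cases "max a b = 0") (auto simp: floor_log_twice)
  also have "\<dots> \<le> floor_log a + floor_log b + 1"
    by (auto simp: max_def)
  finally show ?thesis .
qed

lemma floor_log_mult_le: "floor_log (a * b) \<le> floor_log a + floor_log b + 1"
proof (cases "a * b = 0")
  case False
  have "2 ^ floor_log (a * b) \<le> a * b"
    by (rule floor_log_exp2_le) (use False in auto)
  also have "\<dots> < (2 * 2 ^ floor_log a) * (2 * 2 ^ floor_log b)"
    by (intro mult_strict_mono floor_log_exp2_gt) auto
  also have "\<dots> = 2 ^ (floor_log a + floor_log b + 2)"
    by (simp add: power_add)
  finally have "floor_log (a * b) < floor_log a + floor_log b + 2"
    by (rule power_less_imp_less_exp[rotated]) simp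
  then show ?thesis by simp
qed auto

lemma bit_size_elem_val_le:
  "bit_size (elem_val e x) \<le> bit_size x + (case e of Const c \<Rightarrow> bit_size c | _ \<Rightarrow> 1)"
proof (cases "(e, x)" rule: elem_val.cases)
  case (6 a b)
  then show ?thesis using floor_log_add_le[of a b] by simp
next
  case (7 a b)
  then show ?thesis using floor_log_le_iff[of "a - b" a] by simp
next
  case (8 a b)
  then show ?thesis using floor_log_mult_le[of a b] by simp
next
  case (9 a b)
  then show ?thesis using floor_log_le_iff[of "a div b" a] by simp
qed auto

lemma poly_computable_elem_val: "poly_computable S f (\<lambda>i. elem_val e (f i))"
proof (rule poly_timeI[OF _ exec.Elem])
  let ?u = "\<lambda>i. bit_size (f i)"
  have "poly_bounded S ?u (\<lambda>i. ?u i + (?u i + (case e of Const c \<Rightarrow> bit_size c | _ \<Rightarrow> 1)))"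
    by (intro poly_bounded_intros)
  then show "poly_bounded S ?u (\<lambda>i. ?u i + bit_size (elem_val e (f i)))"
    by (rule poly_bounded_mono) (simp add: bit_size_elem_val_le)
qed

lemma poly_time_elem_val: "poly_time S u f g \<Longrightarrow> poly_time S u f (\<lambda>i. elem_val e (g i))"
  using poly_computable_elem_val by (rule poly_time_comp[rotated])

lemma poly_time_refl: "poly_bounded S u (\<lambda>i. bit_size (f i)) \<Longrightarrow> poly_time S u f f"
  using poly_time_size_mono[OF poly_computable_elem_val[of S f Id]] by simp

lemma poly_computable_refl: "poly_computable S f f"
  by (rule poly_time_refl[OF poly_bounded_refl])

lemma poly_time_const: "poly_bounded S u (\<lambda>i. bit_size (f i)) \<Longrightarrow> poly_time S u f (\<lambda>_. d)"
  using poly_time_elem_val[OF poly_time_refl, of S u f "Const d"] by simp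

lemma poly_time_fst: "poly_time S u f (\<lambda>i. Pair (g i) (h i)) \<Longrightarrow> poly_time S u f g"
  using poly_time_elem_val[of S u f "\<lambda>i. Pair (g i) (h i)" Fst] by simp

lemma poly_time_snd: "poly_time S u f (\<lambda>i. Pair (g i) (h i)) \<Longrightarrow> poly_time S u f h"
  using poly_time_elem_val[of S u f "\<lambda>i. Pair (g i) (h i)" Snd] by simp

lemma
  assumes "poly_time S u f (\<lambda>i. Num (a i))" and "poly_time S u f (\<lambda>i. Num (b i))"
  shows poly_time_add: "poly_time S u f (\<lambda>i. Num (a i + b i))"
    and poly_time_mult: "poly_time S u f (\<lambda>i. Num (a i * b i))"
    and poly_time_div: "poly_time S u f (\<lambda>i. Num (a i div b i))"
  using poly_time_elem_val[OF poly_time_Pair[OF assms], of Add]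
    poly_time_elem_val[OF poly_time_Pair[OF assms], of Mul]
    poly_time_elem_val[OF poly_time_Pair[OF assms], of Div]
  by simp_all


section \<open>Loops over lists\<close>

lemma poly_bounded_fst:
  "poly_bounded S u v \<Longrightarrow> poly_bounded (Sigma S A) (\<lambda>ij. u (fst ij)) (\<lambda>ij. v (fst ij))"
  by (erule poly_bounded_reindex) auto

lemma exec_While_steps:
  assumes "\<And>j. j \<le> n \<Longrightarrow> exec T (st j) (tst j) (r j)" and "\<And>j. j \<le> n \<Longrightarrow> tst j = Num 0 \<longleftrightarrow> j = n"
    and "\<And>j. j < n \<Longrightarrow> exec A (st j) (st (Suc j)) (t j)"
  shows "exec (While T A) (st 0) (st n) ((\<Sum>j\<le>n. 1 + bit_size (st j) + r j) + (\<Sum>j<n. t j))"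
  using assms
proof (induction n arbitrary: st tst r t)
  case 0
  then have "exec T (st 0) (Num 0) (r 0)" by (metis order_refl)
  from exec.While_stop[OF this, of A] show ?case by simp
next
  case (Suc n)
  have "exec (While T A) (st (Suc 0)) (st (Suc n))
      ((\<Sum>j\<le>n. 1 + bit_size (st (Suc j)) + r (Suc j)) + (\<Sum>j<n. t (Suc j)))"
    by (rule Suc.IH[of "\<lambda>j. st (Suc j)" "\<lambda>j. tst (Suc j)"]) (simp_all add: Suc.prems)
  from exec.While_step[OF Suc.prems(1)[of 0] _ Suc.prems(3)[of 0] this]
  show ?case
    by (simp add: Suc.prems(2) sum.atMost_Suc_shift sum.lessThan_Suc_shift add_ac
        del: sum.atMost_Suc sum.lessThan_Suc)
qed

lemma poly_time_While:
  fixes st tst :: "'i \<Rightarrow> nat \<Rightarrow> data"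
  assumes test: "poly_computable (SIGMA i:S. {..len i}) (\<lambda>(i, j). st i j) (\<lambda>(i, j). tst i j)"
    and stop: "\<And>i j. i \<in> S \<Longrightarrow> j \<le> len i \<Longrightarrow> tst i j = Num 0 \<longleftrightarrow> j = len i"
    and body: "poly_computable (SIGMA i:S. {..<len i}) (\<lambda>(i, j). st i j) (\<lambda>(i, j). st i (Suc j))"
    and len: "poly_bounded S u len"
    and size: "poly_bounded (SIGMA i:S. {..len i}) (\<lambda>(i, j). u i) (\<lambda>(i, j). bit_size (st i j))"
  shows "poly_time S u (\<lambda>i. st i 0) (\<lambda>i. st i (len i))"
proof -
  let ?T = "SIGMA i:S. {..len i}" and ?B = "SIGMA i:S. {..<len i}"
  let ?u = "\<lambda>ij. u (fst ij)" and ?s = "\<lambda>ij. bit_size (st (fst ij) (snd ij))"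
  have size_T: "poly_bounded ?T ?u ?s" using size by (simp add: case_prod_unfold)
  have size_B: "poly_bounded ?B ?u ?s" by (rule poly_bounded_subset[OF size_T]) auto
  obtain T \<rho> where time_T: "poly_bounded ?T ?s \<rho>"
    and run_T: "\<And>ij. ij \<in> ?T \<Longrightarrow> exec T (st (fst ij) (snd ij)) (tst (fst ij) (snd ij)) (\<rho> ij)"
    using test unfolding case_prod_unfold by (rule poly_timeE) blast
  obtain A \<tau> where time_A: "poly_bounded ?B ?s \<tau>"
    and run_A: "\<And>ij. ij \<in> ?B \<Longrightarrow> exec A (st (fst ij) (snd ij)) (st (fst ij) (Suc (snd ij))) (\<tau> ij)"
    using body unfolding case_prod_unfold by (rule poly_timeE) blast
  let ?time = "\<lambda>i. (\<Sum>j\<le>len i. 1 + bit_size (st i j) + \<rho> (i, j)) + (\<Sum>j<len i. \<tau> (i, j))"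
  have "poly_bounded ?T ?u (\<lambda>ij. 1 + ?s ij + \<rho> ij)"
    by (intro poly_bounded_intros size_T poly_bounded_trans[OF size_T time_T])
  moreover have "poly_bounded S u (\<lambda>i. len i + 1)" by (intro poly_bounded_intros len)
  ultimately have "poly_bounded S u (\<lambda>i. \<Sum>j\<le>len i. 1 + bit_size (st i j) + \<rho> (i, j))"
    using poly_bounded_sum[of S "\<lambda>i. {..len i}" u "\<lambda>ij. 1 + ?s ij + \<rho> ij"] by simp
  moreover have "poly_bounded S u (\<lambda>i. \<Sum>j<len i. \<tau> (i, j))"
    by (rule poly_bounded_sum) (simp_all add: len poly_bounded_trans[OF size_B time_A])
  ultimately have "poly_bounded S u ?time" by (rule poly_bounded_add)
  then show ?thesis
  proof (rule poly_timeI)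
    show "exec (While T A) (st i 0) (st i (len i)) (?time i)" if "i \<in> S" for i
      by (rule exec_While_steps[of _ _ _ "tst i"])
        (use that run_T[of "(i, _)"] run_A[of "(i, _)"] stop in auto)
  qed
qed

lemma length_le_bit_size_enc_list: "length xs \<le> bit_size (enc_list xs)"
  by (induction xs) auto

lemma bit_size_le_enc_list: "x \<in> set xs \<Longrightarrow> bit_size x \<le> bit_size (enc_list xs)"
  by (induction xs) auto

lemma bit_size_enc_list: "bit_size (enc_list xs) = 1 + (\<Sum>x\<leftarrow>xs. 1 + bit_size x)"
  by (induction xs) auto

lemma bit_size_enc_list_rev: "bit_size (enc_list (rev xs)) = bit_size (enc_list xs)"
  by (simp add: bit_size_enc_list flip: rev_map)

lemma bit_size_enc_list_append:
  "bit_size (enc_list (xs @ ys)) + 1 = bit_size (enc_list xs) + bit_size (enc_list ys)"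
  by (simp add: bit_size_enc_list)

lemma bit_size_enc_list_take_le: "bit_size (enc_list (take j xs)) \<le> bit_size (enc_list xs)"
  and bit_size_enc_list_drop_le: "bit_size (enc_list (drop j xs)) \<le> bit_size (enc_list xs)"
proof -
  have "bit_size (enc_list xs) + 1 = bit_size (enc_list (take j xs)) + bit_size (enc_list (drop j xs))"
    using bit_size_enc_list_append[of "take j xs" "drop j xs"] by simp
  moreover have "1 \<le> bit_size (enc_list ys)" for ys by (simp add: bit_size_enc_list)
  note this[of "take j xs"] this[of "drop j xs"]
  ultimately show "bit_size (enc_list (take j xs)) \<le> bit_size (enc_list xs)"
    and "bit_size (enc_list (drop j xs)) \<le> bit_size (enc_list xs)" by linarith+
qed

lemma bit_size_enc_list_le:
  assumes "\<And>x. x \<in> set xs \<Longrightarrow> bit_size x \<le> b"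
  shows "bit_size (enc_list xs) \<le> 1 + length xs * (1 + b)"
  using assms
proof (induction xs)
  case (Cons x xs)
  then have "bit_size x \<le> b" "bit_size (enc_list xs) \<le> 1 + length xs * (1 + b)" by auto
  then show ?case by simp
qed simp

lemma
  assumes "poly_time S u f (\<lambda>i. enc_list (xs i))" and "\<And>i. i \<in> S \<Longrightarrow> xs i \<noteq> []"
  shows poly_time_hd: "poly_time S u f (\<lambda>i. hd (xs i))"
    and poly_time_tl: "poly_time S u f (\<lambda>i. enc_list (tl (xs i)))"
proof -
  have "poly_time S u f (\<lambda>i. Pair (hd (xs i)) (enc_list (tl (xs i))))"
    using assms(1) by (rule poly_time_cong) (simp_all add: assms(2) flip: enc_list.simps(2))
  then show "poly_time S u f (\<lambda>i. hd (xs i))" and "poly_time S u f (\<lambda>i. enc_list (tl (xs i)))"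
    by (rule poly_time_fst, rule poly_time_snd)
qed

lemma elem_val_IsPair_enc_list_iff: "elem_val IsPair (enc_list xs) = Num 0 \<longleftrightarrow> xs = []"
  by (cases xs) auto

lemma poly_computable_triple:
  fixes a b c :: "'i \<Rightarrow> data"
  defines "f \<equiv> \<lambda>i. Pair (a i) (Pair (b i) (c i))"
  shows "poly_computable S f a" and "poly_computable S f b" and "poly_computable S f c"
proof -
  have triple: "poly_computable S f (\<lambda>i. Pair (a i) (Pair (b i) (c i)))"
    unfolding f_def by (rule poly_computable_refl)
  then show "poly_computable S f a" by (rule poly_time_fst)
  from triple have pair: "poly_computable S f (\<lambda>i. Pair (b i) (c i))" by (rule poly_time_snd)
  then show "poly_computable S f b" by (rule poly_time_fst)
  from pair show "poly_computable S f c" by (rule poly_time_snd)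
qed

definition fold_state :: "('i \<Rightarrow> data) \<Rightarrow> ('i \<Rightarrow> data list) \<Rightarrow> ('i \<Rightarrow> nat \<Rightarrow> data) \<Rightarrow> 'i \<times> nat \<Rightarrow> data" where
  "fold_state e xs acc = (\<lambda>(i, j). Pair (e i) (Pair (enc_list (drop j (xs i))) (acc i j)))"

lemma
  shows poly_computable_fold_state_env: "poly_computable R (fold_state e xs acc) (\<lambda>ij. e (fst ij))"
    and poly_computable_fold_state_rest:
      "poly_computable R (fold_state e xs acc) (\<lambda>ij. enc_list (drop (snd ij) (xs (fst ij))))"
    and poly_computable_fold_state_acc:
      "poly_computable R (fold_state e xs acc) (\<lambda>ij. acc (fst ij) (snd ij))"
  unfolding fold_state_def case_prod_unfold by (rule poly_computable_triple)+

lemma poly_computable_fold_state_Suc: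
  assumes step: "poly_computable (SIGMA i:S. {..<length (xs i)})
    (\<lambda>(i, j). Pair (e i) (Pair (xs i ! j) (acc i j))) (\<lambda>(i, j). acc i (Suc j))"
  shows "poly_computable (SIGMA i:S. {..<length (xs i)}) (fold_state e xs acc)
    (\<lambda>(i, j). fold_state e xs acc (i, Suc j))"
proof -
  let ?B = "SIGMA i:S. {..<length (xs i)}" and ?st = "fold_state e xs acc"
  note env = poly_computable_fold_state_env and rest = poly_computable_fold_state_rest
    and acc = poly_computable_fold_state_acc
  have nonempty: "drop (snd ij) (xs (fst ij)) \<noteq> []" if "ij \<in> ?B" for ij using that by auto
  have "poly_computable ?B ?st (\<lambda>ij. xs (fst ij) ! snd ij)"
    by (rule poly_time_cong[OF poly_time_hd[OF rest nonempty]]) (auto simp: hd_drop_conv_nth)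
  from poly_time_Pair[OF env poly_time_Pair[OF this acc]]
  have "poly_computable ?B ?st (\<lambda>ij. acc (fst ij) (Suc (snd ij)))"
    using step unfolding case_prod_unfold by (rule poly_time_comp)
  moreover have "poly_computable ?B ?st (\<lambda>ij. enc_list (drop (Suc (snd ij)) (xs (fst ij))))"
    using poly_time_tl[OF rest nonempty] by (simp add: drop_Suc tl_drop)
  ultimately have "poly_computable ?B ?st
      (\<lambda>ij. Pair (e (fst ij))
        (Pair (enc_list (drop (Suc (snd ij)) (xs (fst ij)))) (acc (fst ij) (Suc (snd ij)))))"
    by (intro poly_time_Pair env)
  then show ?thesis by (simp add: fold_state_def case_prod_unfold)
qed

lemma poly_time_fold:
  assumes e: "poly_time S u f e" and xs: "poly_time S u f (\<lambda>i. enc_list (xs i))"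
    and init: "poly_time S u f (\<lambda>i. acc i 0)"
    and step: "poly_computable (SIGMA i:S. {..<length (xs i)})
      (\<lambda>(i, j). Pair (e i) (Pair (xs i ! j) (acc i j))) (\<lambda>(i, j). acc i (Suc j))"
    and size: "poly_bounded (SIGMA i:S. {..length (xs i)}) (\<lambda>(i, j). u i) (\<lambda>(i, j). bit_size (acc i j))"
  shows "poly_time S u f (\<lambda>i. acc i (length (xs i)))"
proof -
  let ?st = "fold_state e xs acc" and ?T = "SIGMA i:S. {..length (xs i)}"
  note state_eq = fold_state_def case_prod_unfold
  have xs_size: "poly_bounded S u (\<lambda>i. bit_size (enc_list (xs i)))"
    using xs by (rule poly_time_bit_size_output)
  have "poly_time S u (\<lambda>i. ?st (i, 0)) (\<lambda>i. ?st (i, length (xs i)))"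
  proof (rule poly_time_While[where tst = "\<lambda>i j. elem_val IsPair (enc_list (drop j (xs i)))"])
    show "poly_computable ?T (\<lambda>(i, j). ?st (i, j)) (\<lambda>(i, j). elem_val IsPair (enc_list (drop j (xs i))))"
      unfolding case_prod_unfold prod.collapse
      by (intro poly_time_elem_val poly_computable_fold_state_rest)
    show "elem_val IsPair (enc_list (drop j (xs i))) = Num 0 \<longleftrightarrow> j = length (xs i)"
      if "j \<le> length (xs i)" for i j
      using that by (auto simp: elem_val_IsPair_enc_list_iff)
    show "poly_computable (SIGMA i:S. {..<length (xs i)})
        (\<lambda>(i, j). ?st (i, j)) (\<lambda>(i, j). ?st (i, Suc j))"
      using poly_computable_fold_state_Suc[OF step] by simp
    show "poly_bounded S u (\<lambda>i. length (xs i))"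
      using xs_size length_le_bit_size_enc_list by (rule poly_bounded_mono)
    have "poly_bounded ?T (\<lambda>ij. u (fst ij)) (\<lambda>ij. 1 + bit_size (e (fst ij)) +
        (1 + bit_size (enc_list (xs (fst ij))) + bit_size (acc (fst ij) (snd ij))))"
      by (intro poly_bounded_intros poly_bounded_fst xs_size poly_time_bit_size_output[OF e]
          size[unfolded case_prod_unfold])
    then show "poly_bounded ?T (\<lambda>(i, j). u i) (\<lambda>(i, j). bit_size (?st (i, j)))"
      unfolding state_eq by (rule poly_bounded_mono) (simp add: bit_size_enc_list_drop_le)
  qed
  moreover have "poly_time S u f (\<lambda>i. ?st (i, 0))"
    using e xs init by (simp add: fold_state_def poly_time_Pair)
  ultimately have "poly_time S u f (\<lambda>i. ?st (i, length (xs i)))" by (rule poly_time_trans[rotated])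
  then have "poly_time S u f (\<lambda>i. Pair (e i) (Pair (Num 0) (acc i (length (xs i)))))"
    by (simp add: fold_state_def)
  then show ?thesis by (rule poly_time_snd[OF poly_time_snd])
qed

lemma poly_bounded_enc_list:
  assumes "poly_bounded S u (\<lambda>i. length (xs i))"
    and "poly_bounded (SIGMA i:S. set (xs i)) (\<lambda>(i, x). u i) (\<lambda>(i, x). bit_size x)"
  shows "poly_bounded S u (\<lambda>i. bit_size (enc_list (xs i)))"
proof -
  obtain c where "\<And>i x. i \<in> S \<Longrightarrow> x \<in> set (xs i) \<Longrightarrow> bit_size x \<le> (u i + 2) ^ c"
    using assms(2) unfolding poly_bounded_def by auto
  then have "bit_size (enc_list (xs i)) \<le> 1 + length (xs i) * (1 + (u i + 2) ^ c)" if "i \<in> S" for i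
    using that by (intro bit_size_enc_list_le)
  moreover have "poly_bounded S u (\<lambda>i. 1 + length (xs i) * (1 + (u i + 2) ^ c))"
    by (intro poly_bounded_intros assms(1))
  ultimately show ?thesis by (rule poly_bounded_mono[rotated])
qed

lemma poly_bounded_enc_list_map:
  assumes e: "poly_bounded S u (\<lambda>i. bit_size (e i))"
    and xs: "poly_bounded S u (\<lambda>i. bit_size (enc_list (map enc (xs i))))"
    and \<phi>: "poly_computable (SIGMA i:S. set (xs i)) (\<lambda>(i, x). Pair (e i) (enc x)) (\<lambda>(i, x). \<phi> i x)"
  shows "poly_bounded S u (\<lambda>i. bit_size (enc_list (map (\<phi> i) (xs i))))"
proof (rule poly_bounded_enc_list)
  let ?R = "SIGMA i:S. set (xs i)"
  have "length (map (\<phi> i) (xs i)) \<le> bit_size (enc_list (map enc (xs i)))" for i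
    using length_le_bit_size_enc_list[of "map enc (xs i)"] by simp
  with xs show "poly_bounded S u (\<lambda>i. length (map (\<phi> i) (xs i)))" by (rule poly_bounded_mono)
  have "poly_bounded ?R (\<lambda>ix. u (fst ix))
      (\<lambda>ix. 1 + bit_size (e (fst ix)) + bit_size (enc_list (map enc (xs (fst ix)))))"
    by (intro poly_bounded_intros poly_bounded_fst e xs)
  then have "poly_bounded ?R (\<lambda>ix. u (fst ix)) (\<lambda>ix. bit_size (Pair (e (fst ix)) (enc (snd ix))))"
    by (rule poly_bounded_mono) (auto intro: bit_size_le_enc_list)
  then have "poly_bounded ?R (\<lambda>ix. u (fst ix)) (\<lambda>ix. bit_size (\<phi> (fst ix) (snd ix)))"
    using poly_time_bit_size_output[OF \<phi>] unfolding case_prod_unfold by (rule poly_bounded_trans)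
  then show "poly_bounded (SIGMA i:S. set (map (\<phi> i) (xs i))) (\<lambda>(i, y). u i) (\<lambda>(i, y). bit_size y)"
    unfolding poly_bounded_def by fastforce
qed

lemma poly_time_rev_map:
  assumes e: "poly_time S u f e" and xs: "poly_time S u f (\<lambda>i. enc_list (map enc (xs i)))"
    and \<phi>: "poly_computable (SIGMA i:S. set (xs i)) (\<lambda>(i, x). Pair (e i) (enc x)) (\<lambda>(i, x). \<phi> i x)"
  shows "poly_time S u f (\<lambda>i. enc_list (rev (map (\<phi> i) (xs i))))"
proof -
  let ?acc = "\<lambda>i j. enc_list (rev (map (\<phi> i) (take j (xs i))))"
  have "poly_time S u f (\<lambda>i. ?acc i (length (map enc (xs i))))"
  proof (rule poly_time_fold[OF e xs]; (unfold case_prod_unfold)?)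
    show "poly_time S u f (\<lambda>i. ?acc i 0)"
      using poly_time_const[OF poly_time_bit_size_input[OF e]] by simp
    let ?B = "SIGMA i:S. {..<length (map enc (xs i))}"
    let ?f = "\<lambda>ij. Pair (e (fst ij)) (Pair (map enc (xs (fst ij)) ! snd ij) (?acc (fst ij) (snd ij)))"
    note parts = poly_computable_triple[of ?B "\<lambda>ij. e (fst ij)"
        "\<lambda>ij. map enc (xs (fst ij)) ! snd ij" "\<lambda>ij. ?acc (fst ij) (snd ij)"]
    have "poly_computable ?B ?f (\<lambda>ij. enc (xs (fst ij) ! snd ij))"
      using parts(2) by (rule poly_time_cong) auto
    with parts(1) have "poly_computable ?B ?f (\<lambda>ij. Pair (e (fst ij)) (enc (xs (fst ij) ! snd ij)))"
      by (rule poly_time_Pair)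
    moreover have "poly_computable ?B (\<lambda>ij. Pair (e (fst ij)) (enc (xs (fst ij) ! snd ij)))
        (\<lambda>ij. \<phi> (fst ij) (xs (fst ij) ! snd ij))"
      using poly_time_reindex[OF \<phi>, of "\<lambda>ij. (fst ij, xs (fst ij) ! snd ij)" ?B] by force
    ultimately have "poly_computable ?B ?f (\<lambda>ij. \<phi> (fst ij) (xs (fst ij) ! snd ij))"
      by (rule poly_time_comp)
    from poly_time_Pair[OF this parts(3)]
    show "poly_computable ?B ?f (\<lambda>ij. ?acc (fst ij) (Suc (snd ij)))"
      by (rule poly_time_cong) (auto simp: take_Suc_conv_app_nth)
    have "poly_bounded S u (\<lambda>i. bit_size (enc_list (map (\<phi> i) (xs i))))"
      by (intro poly_bounded_enc_list_map[OF _ _ \<phi>] poly_time_bit_size_output[OF e]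
          poly_time_bit_size_output[OF xs])
    from poly_bounded_fst[OF this]
    show "poly_bounded (SIGMA i:S. {..length (map enc (xs i))}) (\<lambda>ij. u (fst ij))
        (\<lambda>ij. bit_size (?acc (fst ij) (snd ij)))"
      by (rule poly_bounded_mono)
        (simp add: bit_size_enc_list_rev bit_size_enc_list_take_le flip: take_map)
  qed
  then show ?thesis by simp
qed

lemma poly_time_rev:
  assumes "poly_time S u f (\<lambda>i. enc_list (xs i))"
  shows "poly_time S u f (\<lambda>i. enc_list (rev (xs i)))"
proof -
  have "poly_computable (SIGMA i:S. set (xs i)) (\<lambda>ix. Pair (Num 0) (snd ix)) (\<lambda>ix. snd ix)"
    by (rule poly_time_snd[OF poly_computable_refl])
  then have "poly_time S u f (\<lambda>i. enc_list (rev (map (\<lambda>x. x) (xs i))))"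
    using assms poly_time_const[OF poly_time_bit_size_input[OF assms]]
    by (intro poly_time_rev_map[where enc = "\<lambda>x. x" and e = "\<lambda>_. Num 0"]) (auto simp: case_prod_unfold)
  then show ?thesis by simp
qed

lemma poly_time_map:
  assumes "poly_time S u f e" and "poly_time S u f (\<lambda>i. enc_list (map enc (xs i)))"
    and "poly_computable (SIGMA i:S. set (xs i)) (\<lambda>(i, x). Pair (e i) (enc x)) (\<lambda>(i, x). \<phi> i x)"
  shows "poly_time S u f (\<lambda>i. enc_list (map (\<phi> i) (xs i)))"
  using poly_time_rev[OF poly_time_rev_map[OF assms]] by simp

lemma bit_size_Num_le: "bit_size (Num m) \<le> m + 1"
proof (cases "m = 0")
  case False
  then show ?thesis using floor_log_exp2_le[of m] less_exp[of "floor_log m"] by (simp del: less_exp)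
qed simp

lemma poly_time_length:
  assumes xs: "poly_time S u f (\<lambda>i. enc_list (xs i))"
  shows "poly_time S u f (\<lambda>i. Num (length (xs i)))"
proof (rule poly_time_fold[where acc = "\<lambda>i j. Num j", OF poly_time_const xs poly_time_const])
  let ?B = "SIGMA i:S. {..<length (xs i)}" and ?T = "SIGMA i:S. {..length (xs i)}"
  let ?f = "\<lambda>ij. Pair (Num 0) (Pair (xs (fst ij) ! snd ij) (Num (snd ij)))"
  have "poly_computable ?B ?f (\<lambda>ij. Num (snd ij + 1))"
    by (intro poly_time_add poly_time_const poly_bounded_refl)
      (rule poly_time_snd[OF poly_time_snd[OF poly_computable_refl]])
  then show "poly_computable ?B (\<lambda>(i, j). Pair (Num 0) (Pair (xs i ! j) (Num j))) (\<lambda>(i, j). Num (Suc j))"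
    by (simp add: case_prod_unfold)
  have "poly_bounded S u (\<lambda>i. bit_size (enc_list (xs i)) + 1)"
    by (intro poly_bounded_intros poly_time_bit_size_output[OF xs])
  then have "poly_bounded ?T (\<lambda>(i, j). u i) (\<lambda>(i, j). bit_size (enc_list (xs i)) + 1)"
    unfolding case_prod_unfold by (rule poly_bounded_fst)
  then show "poly_bounded ?T (\<lambda>(i, j). u i) (\<lambda>(i, j). bit_size (Num j))"
  proof (rule poly_bounded_mono, clarify)
    fix i j assume "j \<le> length (xs i)"
    then show "bit_size (Num j) \<le> bit_size (enc_list (xs i)) + 1"
      using length_le_bit_size_enc_list[of "xs i"] bit_size_Num_le[of j] by linarith
  qed
qed (intro poly_time_bit_size_input[OF xs])+


section \<open>Encoded vectors and matrices\<close>

lemma poly_time_map_Num: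
  assumes "poly_time S u f e" and "poly_time S u f (\<lambda>i. enc_list (map Num (xs i)))"
    and "poly_computable (S \<times> UNIV) (\<lambda>(i, x). Pair (e i) (Num x)) (\<lambda>(i, x). Num (\<phi> i x))"
  shows "poly_time S u f (\<lambda>i. enc_list (map Num (map (\<phi> i) (xs i))))"
proof -
  have "poly_computable (SIGMA i:S. set (xs i)) (\<lambda>(i, x). Pair (e i) (Num x)) (\<lambda>(i, x). Num (\<phi> i x))"
    by (rule poly_time_subset[OF assms(3)]) auto
  with assms(1,2) have "poly_time S u f (\<lambda>i. enc_list (map (\<lambda>x. Num (\<phi> i x)) (xs i)))"
    by (rule poly_time_map)
  then show ?thesis by (simp add: comp_def)
qed

lemma poly_time_map_vec:
  assumes "poly_time S u f e" and "poly_time S u f (\<lambda>i. enc_vec (v i))"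
    and "poly_computable (S \<times> UNIV) (\<lambda>(i, x). Pair (e i) (Num x)) (\<lambda>(i, x). Num (\<phi> i x))"
  shows "poly_time S u f (\<lambda>i. enc_vec (map_vec (\<phi> i) (v i)))"
proof -
  have "list_of_vec (map_vec h w) = map h (list_of_vec w)" for h :: "nat \<Rightarrow> nat" and w
    by (auto simp: list_of_vec_map)
  then show ?thesis
    using poly_time_map_Num[OF assms(1) assms(2)[unfolded enc_vec_def] assms(3)]
    by (simp only: enc_vec_def)
qed

lemma poly_time_map_mat:
  assumes e: "poly_time S u f e" and M: "poly_time S u f (\<lambda>i. enc_mat (M i))"
    and \<phi>: "poly_computable (S \<times> UNIV) (\<lambda>(i, x). Pair (e i) (Num x)) (\<lambda>(i, x). Num (\<phi> i x))"
  shows "poly_time S u f (\<lambda>i. enc_mat (map_mat (\<phi> i) (M i)))"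
proof -
  let ?R = "SIGMA i:S. set (mat_to_list (M i))"
  let ?f = "\<lambda>ir. Pair (e (fst ir)) (enc_list (map Num (snd ir)))"
  have "poly_computable ?R ?f (\<lambda>ir. e (fst ir))"
    and "poly_computable ?R ?f (\<lambda>ir. enc_list (map Num (snd ir)))"
    by (rule poly_time_fst[OF poly_computable_refl], rule poly_time_snd[OF poly_computable_refl])
  moreover have "poly_computable (?R \<times> UNIV) (\<lambda>(ir, x). Pair (e (fst ir)) (Num x))
      (\<lambda>(ir, x). Num (\<phi> (fst ir) x))"
    using poly_time_reindex[OF \<phi>, of "\<lambda>(ir, x). (fst ir, x)" "?R \<times> UNIV"]
    by (force simp: case_prod_unfold)
  ultimately have row: "poly_computable ?R ?f (\<lambda>ir. enc_list (map Num (map (\<phi> (fst ir)) (snd ir))))"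
    by (rule poly_time_map_Num)
  have "poly_time S u f
      (\<lambda>i. enc_list (map (\<lambda>r. enc_list (map Num (map (\<phi> i) r))) (mat_to_list (M i))))"
    using e M[unfolded enc_mat_def] row by (rule poly_time_map[unfolded case_prod_unfold])
  moreover have "mat_to_list (map_mat h A) = map (map h) (mat_to_list A)" for h :: "nat \<Rightarrow> nat" and A
    by (auto simp: mat_to_list_def)
  ultimately show ?thesis by (simp add: enc_mat_def comp_def)
qed

lemma length_mat_to_list: "length (mat_to_list A) = dim_row A"
  by (simp add: mat_to_list_def)

lemma nth_mat_to_list: "i < dim_row A \<Longrightarrow> mat_to_list A ! i = map (\<lambda>j. A $$ (i, j)) [0..<dim_col A]"
  by (simp add: mat_to_list_def)

lemma poly_time_dim_row:
  assumes "poly_time S u f (\<lambda>i. enc_mat (M i))"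
  shows "poly_time S u f (\<lambda>i. Num (dim_row (M i)))"
  using poly_time_length[OF assms[unfolded enc_mat_def]] by (simp add: length_mat_to_list)

lemma poly_time_dim_col:
  assumes M: "poly_time S u f (\<lambda>i. enc_mat (M i))" and pos: "\<And>i. i \<in> S \<Longrightarrow> 0 < dim_row (M i)"
  shows "poly_time S u f (\<lambda>i. Num (dim_col (M i)))"
proof -
  have rows: "mat_to_list (M i) \<noteq> []" if "i \<in> S" for i
    using pos[OF that] by (simp add: length_mat_to_list flip: length_greater_0_conv)
  have "poly_time S u f (\<lambda>i. hd (map (\<lambda>r. enc_list (map Num r)) (mat_to_list (M i))))"
    using M[unfolded enc_mat_def] by (rule poly_time_hd) (simp add: rows)
  then have "poly_time S u f (\<lambda>i. enc_list (map Num (hd (mat_to_list (M i)))))"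
    by (rule poly_time_cong) (simp_all add: hd_map rows)
  from poly_time_length[OF this] show ?thesis
    by (rule poly_time_cong) (simp_all add: hd_conv_nth rows pos nth_mat_to_list)
qed

lemma
  assumes "0 < dim_row A"
  shows dim_row_le_bit_size: "dim_row A \<le> bit_size (enc_mat A)"
    and dim_col_le_bit_size: "dim_col A \<le> bit_size (enc_mat A)"
proof -
  let ?rows = "map (\<lambda>r. enc_list (map Num r)) (mat_to_list A)"
  show "dim_row A \<le> bit_size (enc_mat A)"
    using length_le_bit_size_enc_list[of ?rows] by (simp add: enc_mat_def length_mat_to_list)
  have "dim_col A \<le> bit_size (enc_list (map Num (mat_to_list A ! 0)))"
    using length_le_bit_size_enc_list[of "map Num (mat_to_list A ! 0)"] assms
    by (simp add: nth_mat_to_list)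
  also have "\<dots> \<le> bit_size (enc_mat A)"
    unfolding enc_mat_def using assms by (intro bit_size_le_enc_list) (simp add: length_mat_to_list)
  finally show "dim_col A \<le> bit_size (enc_mat A)" .
qed

lemma bit_size_enc_list_mono:
  "list_all2 (\<lambda>x y. bit_size x \<le> bit_size y) xs ys \<Longrightarrow> bit_size (enc_list xs) \<le> bit_size (enc_list ys)"
  by (induction rule: list_all2_induct) auto

lemma bit_size_sum_list_le: "bit_size (Num (sum_list r)) \<le> bit_size (enc_list (map Num r))"
proof (induction r)
  case (Cons x r)
  then show ?case using floor_log_add_le[of x "sum_list r"] by simp
qed simp

lemma bit_size_enc_vec_le_enc_mat:
  assumes "dim_vec v = dim_row A"
    and "\<And>i. i < dim_row A \<Longrightarrow> v $ i \<le> (\<Sum>j<dim_col A. A $$ (i, j))"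
  shows "bit_size (enc_vec v) \<le> bit_size (enc_mat A)"
proof -
  have "bit_size (Num (v $ i)) \<le> bit_size (enc_list (map Num (mat_to_list A ! i)))"
    if "i < dim_row A" for i
  proof -
    have "v $ i \<le> sum_list (mat_to_list A ! i)"
      using assms(2)[OF that] that
      by (simp add: nth_mat_to_list sum_list_distinct_conv_sum_set atLeast0LessThan)
    then have "bit_size (Num (v $ i)) \<le> bit_size (Num (sum_list (mat_to_list A ! i)))"
      by (simp add: floor_log_le_iff)
    then show ?thesis using bit_size_sum_list_le by (rule order_trans)
  qed
  then show ?thesis
    unfolding enc_vec_def enc_mat_def using assms(1)
    by (intro bit_size_enc_list_mono)
      (auto simp: list_all2_conv_all_nth length_mat_to_list list_of_vec_index)
qed


section \<open>The objective\<close>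

lemma Max_image_diff_le:
  fixes f g :: "'a \<Rightarrow> 'b :: linordered_idom"
  assumes "finite A" and "A \<noteq> {}" and "0 \<le> \<rho>" and le: "\<And>x. x \<in> A \<Longrightarrow> \<bar>f x - \<rho> * g x\<bar> \<le> c"
  shows "\<bar>Max (f ` A) - \<rho> * Max (g ` A)\<bar> \<le> c"
proof -
  obtain x where x: "x \<in> A" "Max (f ` A) = f x" using Max_in[of "f ` A"] assms(1,2) by blast
  obtain y where y: "y \<in> A" "Max (g ` A) = g y" using Max_in[of "g ` A"] assms(1,2) by blast
  have "\<rho> * g x \<le> \<rho> * g y" and "f y \<le> f x"
    using assms(1,3) x y by (auto simp flip: x(2) y(2) intro!: mult_left_mono)
  then show ?thesis
    unfolding x(2) y(2) using le[OF x(1)] le[OF y(1)] by (simp add: abs_le_iff algebra_simps)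
qed

lemma Min_image_diff_le:
  fixes f g :: "'a \<Rightarrow> 'b :: linordered_idom"
  assumes "finite A" and "A \<noteq> {}" and "0 \<le> \<rho>" and "\<And>x. x \<in> A \<Longrightarrow> \<bar>f x - \<rho> * g x\<bar> \<le> c"
  shows "\<bar>Min (f ` A) - \<rho> * Min (g ` A)\<bar> \<le> c"
proof -
  have Min: "Min (h ` A) = - Max ((\<lambda>x. - h x) ` A)" for h :: "'a \<Rightarrow> 'b"
    using assms(1,2) by (simp add: image_image)
  have "\<bar>Max ((\<lambda>x. - f x) ` A) - \<rho> * Max ((\<lambda>x. - g x) ` A)\<bar> \<le> c"
    using assms(1-3)
  proof (rule Max_image_diff_le)
    show "\<bar>- f x - \<rho> * - g x\<bar> \<le> c" if "x \<in> A" for x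
      using assms(4)[OF that] by (simp add: abs_minus_commute)
  qed
  then show ?thesis unfolding Min by (simp add: abs_minus_commute)
qed

lemma cornered_norm_weightE:
  assumes "1 \<le> p"
  obtains w where "0 \<le> w" and "w \<le> 1"
    and "\<And>v. cornered_norm p v = Max ((\<lambda>i. \<bar>v $ i\<bar>) ` {..<dim_vec v}) + w * (\<Sum>i<dim_vec v. \<bar>v $ i\<bar>)"
proof
  let ?w = "if p = \<infinity> then 0 else 1 / real_of_ereal p"
  show "0 \<le> ?w" and "?w \<le> 1" using assms by (cases p; simp add: one_ereal_def)+
qed (simp add: cornered_norm_def)

lemma cornered_norm_nonneg:
  assumes "1 \<le> p" and "0 < dim_vec v"
  shows "0 \<le> cornered_norm p v"
proof -
  obtain w where "0 \<le> w"
    and "\<And>v. cornered_norm p v =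
      Max ((\<lambda>i. \<bar>v $ i\<bar>) ` {..<dim_vec v}) + w * (\<Sum>i<dim_vec v. \<bar>v $ i\<bar>)"
    using assms(1) by (rule cornered_norm_weightE) blast
  moreover have "\<bar>v $ 0\<bar> \<le> Max ((\<lambda>i. \<bar>v $ i\<bar>) ` {..<dim_vec v})" using assms(2) by simp
  then have "0 \<le> Max ((\<lambda>i. \<bar>v $ i\<bar>) ` {..<dim_vec v})" using abs_ge_zero by (rule order_trans[rotated])
  ultimately show ?thesis by (simp add: sum_nonneg)
qed

lemma cornered_norm_diff_le:
  assumes "1 \<le> p" and "0 < k" and "v \<in> carrier_vec k" and "w \<in> carrier_vec k" and "0 \<le> \<rho>"
    and le: "\<And>i. i < k \<Longrightarrow> \<bar>v $ i - \<rho> * w $ i\<bar> \<le> c"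
  shows "\<bar>cornered_norm p v - \<rho> * cornered_norm p w\<bar> \<le> (real k + 1) * c"
proof -
  obtain \<alpha> where \<alpha>: "0 \<le> \<alpha>" "\<alpha> \<le> 1"
    and norm: "\<And>v. cornered_norm p v =
      Max ((\<lambda>i. \<bar>v $ i\<bar>) ` {..<dim_vec v}) + \<alpha> * (\<Sum>i<dim_vec v. \<bar>v $ i\<bar>)"
    using assms(1) by (rule cornered_norm_weightE) blast
  let ?M = "\<lambda>v. Max ((\<lambda>i. \<bar>v $ i\<bar>) ` {..<k})" and ?s = "\<lambda>v. \<Sum>i<k. \<bar>v $ i\<bar>"
  have le_abs: "\<bar>\<bar>v $ i\<bar> - \<rho> * \<bar>w $ i\<bar>\<bar> \<le> c" if "i < k" for i
    using le[OF that] abs_triangle_ineq3[of "v $ i" "\<rho> * w $ i"] assms(5) by (simp add: abs_mult)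
  have "\<bar>?M v - \<rho> * ?M w\<bar> \<le> c"
    using assms(2,5) le_abs by (intro Max_image_diff_le) auto
  moreover have "\<bar>\<alpha> * (?s v - \<rho> * ?s w)\<bar> \<le> real k * c"
  proof -
    have "\<bar>?s v - \<rho> * ?s w\<bar> \<le> (\<Sum>i<k. \<bar>\<bar>v $ i\<bar> - \<rho> * \<bar>w $ i\<bar>\<bar>)"
      unfolding sum_distrib_left sum_subtractf[symmetric] by (rule sum_abs)
    also have "\<dots> \<le> real k * c"
      using sum_mono[of "{..<k}" "\<lambda>i. \<bar>\<bar>v $ i\<bar> - \<rho> * \<bar>w $ i\<bar>\<bar>" "\<lambda>_. c"] le_abs by simp
    finally show ?thesis
      using mult_mono[of "\<bar>\<alpha>\<bar>" 1] \<alpha> by (fastforce simp: abs_mult)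
  qed
  moreover have "cornered_norm p v - \<rho> * cornered_norm p w
      = (?M v - \<rho> * ?M w) + \<alpha> * (?s v - \<rho> * ?s w)"
    using assms(3,4) by (simp add: norm algebra_simps)
  ultimately show ?thesis by (simp add: algebra_simps)
qed

lemma ref_obj_nonneg:
  assumes "1 \<le> p" and "0 < k" and "ybar \<in> carrier_vec k" and "y \<in> carrier_vec k"
  shows "0 \<le> ref_obj p ybar y"
  using assms unfolding ref_obj_def by (intro add_nonneg_nonneg cornered_norm_nonneg) auto

lemma ref_obj_diff_le:
  assumes "1 \<le> p" and "0 < k" and "0 \<le> \<rho>"
    and carrier: "ybar \<in> carrier_vec k" "y \<in> carrier_vec k" "ybar' \<in> carrier_vec k" "y' \<in> carrier_vec k"
    and ybar: "\<And>i. i < k \<Longrightarrow> \<bar>real (ybar' $ i) - \<rho> * real (ybar $ i)\<bar> \<le> c"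
    and y: "\<And>i. i < k \<Longrightarrow> \<bar>real (y' $ i) - \<rho> * real (y $ i)\<bar> \<le> d"
  shows "\<bar>ref_obj p ybar' y' - \<rho> * ref_obj p ybar y\<bar> \<le> (real k + 1) * (2 * c + d)"
proof -
  let ?b = "map_vec real ybar" and ?b' = "map_vec real ybar'"
  let ?d = "map_vec real y - ?b" and ?d' = "map_vec real y' - ?b'"
  have "\<bar>cornered_norm p ?b' - \<rho> * cornered_norm p ?b\<bar> \<le> (real k + 1) * c"
    using assms by (intro cornered_norm_diff_le) auto
  moreover have "\<bar>cornered_norm p ?d' - \<rho> * cornered_norm p ?d\<bar> \<le> (real k + 1) * (c + d)"
  proof (rule cornered_norm_diff_le)
    fix i assume i: "i < k"
    have "?d' $ i - \<rho> * ?d $ i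
        = (real (y' $ i) - \<rho> * real (y $ i)) - (real (ybar' $ i) - \<rho> * real (ybar $ i))"
      using carrier i by (simp add: algebra_simps)
    then show "\<bar>?d' $ i - \<rho> * ?d $ i\<bar> \<le> c + d"
      using ybar[OF i] y[OF i] by linarith
  qed (use assms in auto)
  moreover have "ref_obj p ybar' y' - \<rho> * ref_obj p ybar y
      = (cornered_norm p ?b' - \<rho> * cornered_norm p ?b) + (cornered_norm p ?d' - \<rho> * cornered_norm p ?d)"
    by (simp add: ref_obj_def algebra_simps)
  ultimately show ?thesis by (simp add: algebra_simps)
qed


section \<open>Instances and their optimal values\<close>

lemma finite_binary_vecs: "finite {x \<in> carrier_vec n. \<forall>j<n. x $ j \<in> {0 :: nat, 1}}"
proof (rule finite_subset)
  show "{x \<in> carrier_vec n. \<forall>j<n. x $ j \<in> {0 :: nat, 1}}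
      \<subseteq> vec_of_list ` {xs. set xs \<subseteq> {0, 1} \<and> length xs = n}"
  proof
    fix x assume x: "x \<in> {x \<in> carrier_vec n. \<forall>j<n. x $ j \<in> {0 :: nat, 1}}"
    have "set (list_of_vec x) \<subseteq> {0, 1}" "length (list_of_vec x) = n"
      using x by (auto simp: set_conv_nth list_of_vec_index)
    then show "x \<in> vec_of_list ` {xs. set xs \<subseteq> {0, 1} \<and> length xs = n}"
      by (intro image_eqI[of _ _ "list_of_vec x"]) (auto simp: vec_list)
  qed
qed (simp add: finite_lists_length_eq)

lemma cost_carrier: "snd I \<in> carrier_mat k n \<Longrightarrow> cost I x \<in> carrier_vec k"
  by (rule carrier_vecI) (simp add: cost_def)

lemma cost_nth:
  assumes "snd I \<in> carrier_mat k n" and "x \<in> carrier_vec n" and "i < k"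
  shows "cost I x $ i = (\<Sum>j<n. snd I $$ (i, j) * x $ j)"
proof -
  have "dim_row (snd I) = k" "dim_col (snd I) = n" "dim_vec x = n" using assms by auto
  then show ?thesis
    using assms(3) by (simp add: cost_def scalar_prod_def atLeast0LessThan)
qed

context
  fixes P :: mc_problem and I :: mc_instance
  assumes problem: "multicriteria_problem P" and inst: "I \<in> instances P"
begin

lemma num_crit_pos: "0 < num_crit P (fst I)"
  and instance_carrier: "snd I \<in> carrier_mat (num_crit P (fst I)) (num_vars P (fst I))"
  and solutions_nonempty: "solutions P I \<noteq> {}"
  and solutions_subset_binary_vecs: "solutions P I
    \<subseteq> {x \<in> carrier_vec (num_vars P (fst I)). \<forall>j<num_vars P (fst I). x $ j \<in> {0, 1}}"
  using problem inst by (fastforce simp: multicriteria_problem_def instances_def solutions_def)+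

lemma dim_row_pos: "0 < dim_row (snd I)"
  using num_crit_pos instance_carrier by simp

lemma finite_solutions: "finite (solutions P I)"
  using solutions_subset_binary_vecs finite_binary_vecs by (rule finite_subset)

lemma solution_carrier: "x \<in> solutions P I \<Longrightarrow> x \<in> carrier_vec (num_vars P (fst I))"
  and solution_binary: "x \<in> solutions P I \<Longrightarrow> j < num_vars P (fst I) \<Longrightarrow> x $ j \<in> {0, 1}"
  using solutions_subset_binary_vecs by blast+

lemma reference_points_iff:
  "ybar \<in> reference_points P I \<longleftrightarrow> ybar \<in> carrier_vec (num_crit P (fst I)) \<and>
    (\<forall>i<num_crit P (fst I). \<forall>x\<in>solutions P I. ybar $ i \<le> cost I x $ i)"
proof -
  have "m \<le> Min ((\<lambda>x. cost I x $ i) ` solutions P I) \<longleftrightarrow> (\<forall>x\<in>solutions P I. m \<le> cost I x $ i)" for m i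
    using finite_solutions solutions_nonempty by simp
  then show ?thesis by (simp add: reference_points_def ideal_point_def)
qed

lemma opt_val_nonneg:
  assumes "1 \<le> p" and "ybar \<in> reference_points P I"
  shows "0 \<le> opt_val P p I ybar"
  unfolding opt_val_def
proof (rule Min.boundedI)
  show "0 \<le> r" if "r \<in> (\<lambda>x. ref_obj p ybar (cost I x)) ` solutions P I" for r
    using that assms ref_obj_nonneg[OF assms(1) num_crit_pos _ cost_carrier[OF instance_carrier]]
    by (auto simp: reference_points_iff)
qed (simp_all add: finite_solutions solutions_nonempty)

lemma bit_size_reference_point_le:
  assumes "ybar \<in> reference_points P I"
  shows "bit_size (enc_vec ybar) \<le> bit_size (enc_mat (snd I))"
proof (rule bit_size_enc_vec_le_enc_mat)
  let ?k = "num_crit P (fst I)" and ?n = "num_vars P (fst I)"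
  obtain x where x: "x \<in> solutions P I" using solutions_nonempty by blast
  show "dim_vec ybar = dim_row (snd I)"
    using assms instance_carrier by (auto simp: reference_points_iff)
  fix i assume "i < dim_row (snd I)"
  then have i: "i < ?k" using instance_carrier by simp
  then have "ybar $ i \<le> cost I x $ i" using assms x by (simp add: reference_points_iff)
  also have "\<dots> = (\<Sum>j<?n. snd I $$ (i, j) * x $ j)"
    using instance_carrier solution_carrier[OF x] i by (rule cost_nth)
  also have "\<dots> \<le> (\<Sum>j<?n. snd I $$ (i, j))"
    using solution_binary[OF x] by (intro sum_mono) fastforce
  finally show "ybar $ i \<le> (\<Sum>j<dim_col (snd I). snd I $$ (i, j))" using instance_carrier by simp
qed

end


section \<open>Rounding cost matrices and reference points\<close>

definition scale :: "nat \<Rightarrow> nat \<Rightarrow> nat \<Rightarrow> nat" where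
  "scale K a c = K * c div a"

lemma scale_le: "real (scale K a c) \<le> real K / real a * real c"
  using of_nat_div_le_of_nat[of "K * c" a] by (simp add: scale_def)

lemma le_scale_add_1: "real K / real a * real c \<le> real (scale K a c) + 1"
  using real_of_int_floor_add_one_ge[of "real (K * c) / real a"]
  by (simp add: scale_def floor_divide_of_nat_eq flip: of_nat_mult)

text \<open>Costs are rounded up, so that scaled reference points stay below the scaled ideal point.\<close>

definition scaled_instance :: "nat \<Rightarrow> nat \<Rightarrow> mc_instance \<Rightarrow> mc_instance" where
  "scaled_instance K a I = (fst I, map_mat (\<lambda>c. scale K a c + 1) (snd I))"

definition rounding_error :: "nat mat \<Rightarrow> nat" where
  "rounding_error C = (dim_row C + 1) * (dim_col C + 2)"

lemma fst_scaled_instance [simp]: "fst (scaled_instance K a I) = fst I"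
  by (simp add: scaled_instance_def)

lemma solutions_scaled_instance [simp]: "solutions P (scaled_instance K a I) = solutions P I"
  by (simp add: solutions_def)

lemma scaled_instance_in_instances: "I \<in> instances P \<Longrightarrow> scaled_instance K a I \<in> instances P"
  by (auto simp: instances_def scaled_instance_def)

lemma cost_scaled_instance_bounds:
  assumes carrier: "snd I \<in> carrier_mat k n" and x: "x \<in> carrier_vec n" "\<And>j. j < n \<Longrightarrow> x $ j \<in> {0, 1}"
    and i: "i < k"
  shows "real K / real a * real (cost I x $ i) \<le> real (cost (scaled_instance K a I) x $ i)"
    and "real (cost (scaled_instance K a I) x $ i) \<le> real K / real a * real (cost I x $ i) + real n"
proof -
  let ?\<rho> = "real K / real a" and ?c = "\<lambda>j. snd I $$ (i, j)"
  have scaled_carrier: "snd (scaled_instance K a I) \<in> carrier_mat k n"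
    using carrier by (simp add: scaled_instance_def)
  have cost: "cost (scaled_instance K a I) x $ i = (\<Sum>j<n. (scale K a (?c j) + 1) * x $ j)"
    using carrier i unfolding cost_nth[OF scaled_carrier x(1) i]
    by (intro sum.cong) (auto simp: scaled_instance_def)
  have lower: "?\<rho> * real (?c j * x $ j) \<le> real ((scale K a (?c j) + 1) * x $ j)"
    and upper: "real ((scale K a (?c j) + 1) * x $ j) \<le> ?\<rho> * real (?c j * x $ j) + 1" if "j < n" for j
    using x(2)[OF that] scale_le[of K a "?c j"] le_scale_add_1[of K a "?c j"] by auto
  show "?\<rho> * real (cost I x $ i) \<le> real (cost (scaled_instance K a I) x $ i)"
    unfolding cost cost_nth[OF carrier x(1) i] of_nat_sum sum_distrib_left by (intro sum_mono lower) simp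
  have "real (cost (scaled_instance K a I) x $ i) \<le> (\<Sum>j<n. ?\<rho> * real (?c j * x $ j) + 1)"
    unfolding cost of_nat_sum by (intro sum_mono upper) simp
  then show "real (cost (scaled_instance K a I) x $ i) \<le> ?\<rho> * real (cost I x $ i) + real n"
    unfolding cost_nth[OF carrier x(1) i] of_nat_sum sum_distrib_left by (simp add: sum.distrib)
qed

lemma ref_obj_scaled_instance:
  assumes "1 \<le> p" and "0 < k" and carrier: "snd I \<in> carrier_mat k n" and ybar: "ybar \<in> carrier_vec k"
    and x: "x \<in> carrier_vec n" "\<And>j. j < n \<Longrightarrow> x $ j \<in> {0, 1}"
  shows "\<bar>ref_obj p (map_vec (scale K a) ybar) (cost (scaled_instance K a I) x)
    - real K / real a * ref_obj p ybar (cost I x)\<bar> \<le> real (rounding_error (snd I))"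
proof -
  have scaled_carrier: "snd (scaled_instance K a I) \<in> carrier_mat k n"
    using carrier by (simp add: scaled_instance_def)
  have "\<bar>ref_obj p (map_vec (scale K a) ybar) (cost (scaled_instance K a I) x)
    - real K / real a * ref_obj p ybar (cost I x)\<bar> \<le> (real k + 1) * (2 * 1 + real n)"
  proof (rule ref_obj_diff_le[OF assms(1,2) _
        ybar cost_carrier[OF carrier] _ cost_carrier[OF scaled_carrier]])
    fix i assume i: "i < k"
    show "\<bar>real (map_vec (scale K a) ybar $ i) - real K / real a * real (ybar $ i)\<bar> \<le> 1"
      using scale_le[of K a "ybar $ i"] le_scale_add_1[of K a "ybar $ i"] i ybar by auto
    show "\<bar>real (cost (scaled_instance K a I) x $ i) - real K / real a * real (cost I x $ i)\<bar> \<le> real n"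
      using cost_scaled_instance_bounds[OF carrier x i, of K a] by linarith
  qed (use ybar in auto)
  also have "\<dots> = real (rounding_error (snd I))"
    using carrier by (auto simp: rounding_error_def algebra_simps)
  finally show ?thesis .
qed

lemma scaled_reference_point:
  assumes problem: "multicriteria_problem P" and inst: "I \<in> instances P"
    and point: "ybar \<in> reference_points P I"
  shows "map_vec (scale K a) ybar \<in> reference_points P (scaled_instance K a I)"
proof -
  have "scale K a (ybar $ i) \<le> cost (scaled_instance K a I) x $ i"
    if i: "i < num_crit P (fst I)" and x: "x \<in> solutions P I" for i x
  proof -
    have "real (scale K a (ybar $ i)) \<le> real K / real a * real (ybar $ i)" by (rule scale_le)
    also have "\<dots> \<le> real K / real a * real (cost I x $ i)"
      using point i x by (intro mult_left_mono) (auto simp: reference_points_iff[OF problem inst])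
    also have "\<dots> \<le> real (cost (scaled_instance K a I) x $ i)"
      using instance_carrier[OF problem inst] solution_carrier[OF problem inst x]
        solution_binary[OF problem inst x] i
      by (rule cost_scaled_instance_bounds)
    finally show ?thesis by simp
  qed
  then show ?thesis
    using point reference_points_iff[OF problem scaled_instance_in_instances[OF inst]]
    by (auto simp: reference_points_iff[OF problem inst])
qed

lemma opt_val_scaled_instance:
  assumes exponent: "1 \<le> p" and problem: "multicriteria_problem P" and inst: "I \<in> instances P"
    and point: "ybar \<in> reference_points P I"
  shows "\<bar>opt_val P p (scaled_instance K a I) (map_vec (scale K a) ybar)
    - real K / real a * opt_val P p I ybar\<bar> \<le> real (rounding_error (snd I))"
proof -
  have "ybar \<in> carrier_vec (num_crit P (fst I))"
    using point by (simp add: reference_points_iff[OF problem inst])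
  then show ?thesis
    unfolding opt_val_def solutions_scaled_instance
    using num_crit_pos[OF problem inst] instance_carrier[OF problem inst]
      solution_carrier[OF problem inst] solution_binary[OF problem inst]
    by (intro Min_image_diff_le finite_solutions[OF problem inst] solutions_nonempty[OF problem inst]
        ref_obj_scaled_instance[OF exponent]) auto
qed

lemma scaled_optimum_near_optimal:
  assumes exponent: "1 \<le> p" and problem: "multicriteria_problem P" and inst: "I \<in> instances P"
    and point: "ybar \<in> reference_points P I" and solution: "x \<in> solutions P I"
    and optimal: "ref_obj p (map_vec (scale K a) ybar) (cost (scaled_instance K a I) x)
      = opt_val P p (scaled_instance K a I) (map_vec (scale K a) ybar)"
  shows "real K / real a * ref_obj p ybar (cost I x)
    \<le> real K / real a * opt_val P p I ybar + 2 * real (rounding_error (snd I))"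
proof -
  have "ybar \<in> carrier_vec (num_crit P (fst I))"
    using point by (simp add: reference_points_iff[OF problem inst])
  from ref_obj_scaled_instance[OF exponent num_crit_pos[OF problem inst]
      instance_carrier[OF problem inst] this
      solution_carrier[OF problem inst solution] solution_binary[OF problem inst solution], of K a]
    opt_val_scaled_instance[OF exponent problem inst point, of K a] optimal
  show ?thesis by linarith
qed

lemma poly_computable_scale:
  "poly_computable (S \<times> UNIV) (\<lambda>(i, x). Pair (Pair (Num (K i)) (Num (a i))) (Num x))
    (\<lambda>(i, x). Num (scale (K i) (a i) x))"
proof -
  let ?f = "\<lambda>ix. Pair (Pair (Num (K (fst ix))) (Num (a (fst ix)))) (Num (snd ix))"
  have f: "poly_computable (S \<times> UNIV) ?f ?f" by (rule poly_computable_refl)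
  note Ka = poly_time_fst[OF f] and x = poly_time_snd[OF f]
  show ?thesis
    unfolding scale_def case_prod_unfold
    by (intro poly_time_div poly_time_mult poly_time_fst[OF Ka] poly_time_snd[OF Ka] x)
qed

lemma poly_time_scaled_input:
  assumes input: "poly_time S u f (\<lambda>i. enc_input (I i) (ybar i))"
    and K: "poly_time S u f (\<lambda>i. Num (K i))" and a: "poly_time S u f (\<lambda>i. Num (a i))"
  shows "poly_time S u f
    (\<lambda>i. enc_input (scaled_instance (K i) (a i) (I i)) (map_vec (scale (K i) (a i)) (ybar i)))"
proof -
  note Ka = poly_time_Pair[OF K a]
  have inst: "poly_time S u f (\<lambda>i. Pair (fst (I i)) (enc_mat (snd (I i))))"
    and y: "poly_time S u f (\<lambda>i. enc_vec (ybar i))"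
    using input unfolding enc_input_def enc_instance_def by (rule poly_time_fst, rule poly_time_snd)
  have "poly_time S u f (\<lambda>i. enc_vec (map_vec (scale (K i) (a i)) (ybar i)))"
    using Ka y poly_computable_scale by (rule poly_time_map_vec)
  moreover have "poly_computable (S \<times> UNIV)
      (\<lambda>ix. Pair (Pair (Num (K (fst ix))) (Num (a (fst ix)))) (Num (snd ix)))
      (\<lambda>ix. Num (scale (K (fst ix)) (a (fst ix)) (snd ix) + 1))"
    using poly_computable_scale[of S K a] unfolding case_prod_unfold
    by (intro poly_time_add poly_time_const poly_bounded_refl)
  then have "poly_time S u f (\<lambda>i. enc_mat (map_mat (\<lambda>c. scale (K i) (a i) c + 1) (snd (I i))))"
    using poly_time_map_mat[OF Ka poly_time_snd[OF inst]] by (simp add: case_prod_unfold)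
  ultimately show ?thesis
    unfolding enc_input_def enc_instance_def scaled_instance_def fst_conv snd_conv
    by (intro poly_time_Pair poly_time_fst[OF inst])
qed

lemma poly_time_rounding_error:
  assumes M: "poly_time S u f (\<lambda>i. enc_mat (M i))" and "\<And>i. i \<in> S \<Longrightarrow> 0 < dim_row (M i)"
  shows "poly_time S u f (\<lambda>i. Num (rounding_error (M i)))"
  unfolding rounding_error_def
  by (intro poly_time_mult poly_time_add poly_time_const poly_time_dim_row poly_time_dim_col
      poly_time_bit_size_input[OF M] assms)

lemma poly_bounded_rounding_error:
  assumes "poly_bounded S u (\<lambda>i. bit_size (enc_mat (M i)))" and "\<And>i. i \<in> S \<Longrightarrow> 0 < dim_row (M i)"
  shows "poly_bounded S u (\<lambda>i. rounding_error (M i))"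
proof -
  have "poly_bounded S u (\<lambda>i. dim_row (M i))" and "poly_bounded S u (\<lambda>i. dim_col (M i))"
    using assms(2)
    by (auto intro: poly_bounded_mono[OF assms(1)] dim_row_le_bit_size dim_col_le_bit_size)
  then show ?thesis unfolding rounding_error_def by (intro poly_bounded_intros)
qed


section \<open>The approximation scheme\<close>

definition inputs :: "mc_problem \<Rightarrow> (mc_instance \<times> nat vec) set" where
  "inputs P = (SIGMA I:instances P. reference_points P I)"

text \<open>
  The task \<open>(m, I, ybar)\<close> asks for a solution of relative error at most \<open>1 / m\<close>. Its size involves the
  value of \<open>m\<close>, not its length, as an FPTAS may take time polynomial in the reciprocal of the error.
\<close>

definition tasks :: "mc_problem \<Rightarrow> (nat \<times> mc_instance \<times> nat vec) set" where
  "tasks P = {0<..} \<times> inputs P"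

definition task_size :: "nat \<times> mc_instance \<times> nat vec \<Rightarrow> nat" where
  "task_size = (\<lambda>(m, I, ybar). m + bit_size (enc_instance I))"

definition enc_task :: "nat \<times> mc_instance \<times> nat vec \<Rightarrow> data" where
  "enc_task = (\<lambda>(m, I, ybar). Pair (Num m) (enc_input I ybar))"

lemma mem_tasks_iff [simp]:
  "(m, I, ybar) \<in> tasks P \<longleftrightarrow> 0 < m \<and> I \<in> instances P \<and> ybar \<in> reference_points P I"
  by (simp add: tasks_def inputs_def)

lemma poly_bounded_enc_task:
  assumes "multicriteria_problem P"
  shows "poly_bounded (tasks P) task_size (\<lambda>t. bit_size (enc_task t))"
proof (rule poly_bounded_mono)
  show "poly_bounded (tasks P) task_size (\<lambda>t. 3 + 2 * task_size t)"
    by (intro poly_bounded_intros)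
  fix t assume "t \<in> tasks P"
  then obtain m I ybar where t: "t = (m, I, ybar)"
    and inst: "I \<in> instances P" and point: "ybar \<in> reference_points P I"
    by (cases t) auto
  have "bit_size (enc_vec ybar) \<le> bit_size (enc_mat (snd I))"
    using assms inst point by (rule bit_size_reference_point_le)
  then show "bit_size (enc_task t) \<le> 3 + 2 * task_size t"
    using bit_size_Num_le[of m]
    by (simp add: t enc_task_def task_size_def enc_input_def enc_instance_def)
qed

lemma exec_with_constant:
  assumes "exec A (Pair c x) y t"
  shows "exec (Seq (Fork (Elem (Const c)) (Elem Id)) A) x y (2 + 4 * bit_size x + bit_size c + t)"
proof -
  have "1 + bit_size x + (bit_size x + bit_size c) + (bit_size x + bit_size x)
      = 1 + 4 * bit_size x + bit_size c" by simp
  then have "exec (Fork (Elem (Const c)) (Elem Id)) x (Pair c x) (1 + 4 * bit_size x + bit_size c)"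
    using exec.Fork[OF exec.Elem[of "Const c" x] exec.Elem[of Id x]] by (simp only: elem_val.simps)
  from exec.Seq[OF this assms] show ?thesis by simp
qed

lemma nat_inverse_approxE:
  fixes \<epsilon> :: real
  assumes "0 < \<epsilon>"
  obtains m :: nat where "0 < m" and "1 / real m \<le> \<epsilon>" and "real m \<le> 1 / \<epsilon> + 1"
proof
  define m where "m = nat \<lceil>1 / \<epsilon>\<rceil>"
  have "0 < 1 / \<epsilon>" using assms by simp
  then have m: "1 / \<epsilon> \<le> real m" "real m \<le> 1 / \<epsilon> + 1" unfolding m_def by linarith+
  with \<open>0 < 1 / \<epsilon>\<close> have pos: "0 < real m" by linarith
  then show "0 < m" by simp
  show "1 / real m \<le> \<epsilon>" using m(1) pos assms by (simp add: field_simps)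
  show "real m \<le> 1 / \<epsilon> + 1" by (rule m(2))
qed

lemma poly_time_fix_accuracyE:
  assumes time: "poly_time (tasks P) task_size enc_task g"
  obtains q where "\<And>m r. 0 < m \<Longrightarrow> real m \<le> r + 1 \<Longrightarrow>
    \<exists>A. \<forall>I\<in>instances P. \<forall>ybar\<in>reference_points P I.
      runs_within A (enc_input I ybar) (g (m, I, ybar)) (poly2 q (encoding_length I) r)"
proof -
  obtain A \<tau> where time_A: "poly_bounded (tasks P) task_size \<tau>"
    and run_A: "\<And>t. t \<in> tasks P \<Longrightarrow> exec A (enc_task t) (g t) (\<tau> t)"
    using time by (rule poly_timeE) blast
  have "poly_bounded (tasks P) task_size (\<lambda>t. 2 + 4 * bit_size (enc_task t) + \<tau> t)"
    by (intro poly_bounded_intros time_A poly_time_bit_size_input[OF time])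
  then obtain c where time_le:
    "\<And>t. t \<in> tasks P \<Longrightarrow> 2 + 4 * bit_size (enc_task t) + \<tau> t \<le> (task_size t + 2) ^ c"
    by (rule poly_boundedE) blast
  define q :: "real poly poly" where "q = [:[:3, 1:], 1:] ^ c"
  have poly2_q: "poly2 q x y = (x + y + 3) ^ c" for x y
    by (simp add: q_def poly2_def poly_power add_ac)
  have "runs_within (Seq (Fork (Elem (Const (Num m))) (Elem Id)) A) (enc_input I ybar) (g (m, I, ybar))
      (poly2 q (encoding_length I) r)"
    if "0 < m" and m: "real m \<le> r + 1" and "I \<in> instances P" and "ybar \<in> reference_points P I"
    for m r I ybar
  proof -
    let ?t = "(m, I, ybar)"
    let ?time = "2 + 4 * bit_size (enc_input I ybar) + bit_size (Num m) + \<tau> ?t"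
    have task: "?t \<in> tasks P" using that by simp
    have "?time \<le> 2 + 4 * bit_size (enc_task ?t) + \<tau> ?t" by (simp add: enc_task_def)
    also have "\<dots> \<le> (task_size ?t + 2) ^ c" using task by (rule time_le)
    finally have "real ?time \<le> real ((task_size ?t + 2) ^ c)" by (rule of_nat_mono)
    also have "\<dots> = (encoding_length I + real m + 2) ^ c"
      by (simp add: task_size_def encoding_length_def add_ac)
    also have "\<dots> \<le> poly2 q (encoding_length I) r"
      unfolding poly2_q using m by (intro power_mono) (auto simp: encoding_length_def)
    finally show ?thesis
      using exec_with_constant[OF run_A[OF task, unfolded enc_task_def prod.case]]
      unfolding runs_within_def by blast
  qed
  then show thesis using that by blast
qed

lemma has_fptasI:
  assumes problem: "multicriteria_problem P" and exponent: "1 \<le> p"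
    and time: "poly_time (tasks P) task_size enc_task (\<lambda>t. enc_vec (X t))"
    and solution: "\<And>m I ybar. (m, I, ybar) \<in> tasks P \<Longrightarrow> X (m, I, ybar) \<in> solutions P I"
    and accuracy: "\<And>m I ybar. (m, I, ybar) \<in> tasks P \<Longrightarrow>
      ref_obj p ybar (cost I (X (m, I, ybar))) \<le> (1 + 1 / real m) * opt_val P p I ybar"
  shows "has_fptas P p"
proof -
  obtain q where program: "\<And>m r. 0 < m \<Longrightarrow> real m \<le> r + 1 \<Longrightarrow>
      \<exists>A. \<forall>I\<in>instances P. \<forall>ybar\<in>reference_points P I.
        runs_within A (enc_input I ybar) (enc_vec (X (m, I, ybar))) (poly2 q (encoding_length I) r)"
    using time by (rule poly_time_fix_accuracyE) blast
  have "\<exists>A. \<forall>I\<in>instances P. \<forall>ybar\<in>reference_points P I. \<exists>x\<in>solutions P I.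
      runs_within A (enc_input I ybar) (enc_vec x) (poly2 q (encoding_length I) (1 / \<epsilon>)) \<and>
      ref_obj p ybar (cost I x) \<le> (1 + \<epsilon>) * opt_val P p I ybar" if pos: "0 < \<epsilon>" for \<epsilon>
  proof -
    obtain m where m: "0 < m" "1 / real m \<le> \<epsilon>" "real m \<le> 1 / \<epsilon> + 1"
      using pos by (rule nat_inverse_approxE)
    have "X (m, I, ybar) \<in> solutions P I \<and>
        ref_obj p ybar (cost I (X (m, I, ybar))) \<le> (1 + \<epsilon>) * opt_val P p I ybar"
      if inst: "I \<in> instances P" and point: "ybar \<in> reference_points P I" for I ybar
    proof -
      have task: "(m, I, ybar) \<in> tasks P" using m(1) inst point by simp
      have "(1 + 1 / real m) * opt_val P p I ybar \<le> (1 + \<epsilon>) * opt_val P p I ybar"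
        using m(2) opt_val_nonneg[OF problem inst exponent point] by (intro mult_right_mono) auto
      then show ?thesis using solution[OF task] accuracy[OF task] by simp
    qed
    then show ?thesis using program[OF m(1,3)] by blast
  qed
  then show ?thesis unfolding has_fptas_def by blast
qed

lemma runs_within_mono: "runs_within A x y s \<Longrightarrow> s \<le> t \<Longrightarrow> runs_within A x y t"
  unfolding runs_within_def by (meson order_trans)

lemma runs_within_poly_timeE:
  assumes time: "poly_bounded S u \<tau>"
    and "\<And>i. i \<in> S \<Longrightarrow> \<exists>y. R i y \<and> runs_within A (f i) (enc y) (real (\<tau> i))"
  obtains g where "\<And>i. i \<in> S \<Longrightarrow> R i (g i)" and "poly_time S u f (\<lambda>i. enc (g i))"
proof -
  have "\<forall>i\<in>S. \<exists>y. R i y \<and> (\<exists>t. exec A (f i) (enc y) t \<and> t \<le> \<tau> i)"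
    using assms(2) by (simp add: runs_within_def)
  then obtain g where g: "\<forall>i\<in>S. R i (g i) \<and> (\<exists>t. exec A (f i) (enc (g i)) t \<and> t \<le> \<tau> i)"
    by (rule bchoice[THEN exE])
  then obtain \<sigma> where \<sigma>: "\<forall>i\<in>S. exec A (f i) (enc (g i)) (\<sigma> i) \<and> \<sigma> i \<le> \<tau> i" by metis
  have "poly_bounded S u \<sigma>" using time by (rule poly_bounded_mono) (simp add: \<sigma>)
  then have "poly_time S u f (\<lambda>i. enc (g i))" by (rule poly_timeI) (use \<sigma> in blast)
  with g show thesis using that by blast
qed

definition poly_time_fraction ::
    "mc_problem \<Rightarrow> (mc_instance \<Rightarrow> nat vec \<Rightarrow> nat) \<Rightarrow> (mc_instance \<Rightarrow> nat vec \<Rightarrow> nat) \<Rightarrow> bool" where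
  "poly_time_fraction P a b \<longleftrightarrow> poly_time (inputs P) (\<lambda>(I, ybar). bit_size (enc_instance I))
     (\<lambda>(I, ybar). enc_input I ybar) (\<lambda>(I, ybar). Pair (Num (a I ybar)) (Num (b I ybar)))"

lemma poly_time_lower_bound_fractionE:
  assumes "\<exists>A. \<forall>I\<in>instances P. \<forall>ybar\<in>reference_points P I.
    \<exists>l u. represents l (L I ybar) \<and> represents u (U I ybar) \<and>
      runs_within A (enc_input I ybar) (Pair l u) (poly q (encoding_length I))"
  obtains a b where
    "\<And>I ybar. I \<in> instances P \<Longrightarrow> ybar \<in> reference_points P I \<Longrightarrow>
      0 < b I ybar \<and> L I ybar = real (a I ybar) / real (b I ybar)"
    and "poly_time_fraction P a b"
proof -
  let ?size = "\<lambda>i :: mc_instance \<times> nat vec. bit_size (enc_instance (fst i))"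
  let ?enc = "\<lambda>(a, b, u). Pair (Pair (Num a) (Num b)) u"
  obtain A where run_A: "\<And>I ybar. I \<in> instances P \<Longrightarrow> ybar \<in> reference_points P I \<Longrightarrow>
      \<exists>l u. represents l (L I ybar) \<and> represents u (U I ybar) \<and>
        runs_within A (enc_input I ybar) (Pair l u) (poly q (encoding_length I))"
    using assms by blast
  obtain g where g_correct: "\<And>i. i \<in> inputs P \<Longrightarrow>
      (case g i of (a, b, u) \<Rightarrow> 0 < b \<and> L (fst i) (snd i) = real a / real b)"
    and time: "poly_time (inputs P) ?size (\<lambda>i. enc_input (fst i) (snd i)) (\<lambda>i. ?enc (g i))"
  proof (rule runs_within_poly_timeE)
    show "poly_bounded (inputs P) ?size (\<lambda>i. nat \<lceil>poly q (real (?size i))\<rceil>)"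
      by (intro poly_bounded_poly poly_bounded_refl)
    fix i assume "i \<in> inputs P"
    then obtain a b u where "0 < b" and "L (fst i) (snd i) = real a / real b"
      and "runs_within A (enc_input (fst i) (snd i)) (?enc (a, b, u)) (poly q (encoding_length (fst i)))"
      using run_A[of "fst i" "snd i"] by (auto simp: inputs_def represents_def)
    then show "\<exists>y. (case y of (a, b, u) \<Rightarrow> 0 < b \<and> L (fst i) (snd i) = real a / real b) \<and>
        runs_within A (enc_input (fst i) (snd i)) (?enc y) (real (nat \<lceil>poly q (real (?size i))\<rceil>))"
      using runs_within_mono[OF _ real_nat_ceiling_ge] unfolding encoding_length_def by fast
  qed blast
  show thesis
  proof (rule that[of "\<lambda>I ybar. fst (snd (g (I, ybar)))" "\<lambda>I ybar. fst (g (I, ybar))"])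
    show "0 < fst (snd (g (I, ybar))) \<and>
        L I ybar = real (fst (g (I, ybar))) / real (fst (snd (g (I, ybar))))"
      if "I \<in> instances P" "ybar \<in> reference_points P I" for I ybar
      using g_correct[of "(I, ybar)"] that by (simp add: inputs_def case_prod_unfold)
    show "poly_time_fraction P (\<lambda>I ybar. fst (g (I, ybar))) (\<lambda>I ybar. fst (snd (g (I, ybar))))"
      using time unfolding poly_time_fraction_def case_prod_unfold prod.collapse
      by (rule poly_time_fst)
  qed
qed

locale bracketed_mc_problem =
  fixes P :: mc_problem and p :: ereal
    and a b :: "mc_instance \<Rightarrow> nat vec \<Rightarrow> nat" and U :: "mc_instance \<Rightarrow> nat vec \<Rightarrow> real"
    and \<pi> :: "real poly"
  assumes problem: "multicriteria_problem P" and exponent: "1 \<le> p"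
    and denominator_pos: "\<lbrakk>I \<in> instances P; ybar \<in> reference_points P I\<rbrakk> \<Longrightarrow> 0 < b I ybar"
    and lower_bound: "\<lbrakk>I \<in> instances P; ybar \<in> reference_points P I\<rbrakk> \<Longrightarrow>
      real (a I ybar) / real (b I ybar) \<le> opt_val P p I ybar"
    and upper_bound: "\<lbrakk>I \<in> instances P; ybar \<in> reference_points P I\<rbrakk> \<Longrightarrow> opt_val P p I ybar \<le> U I ybar"
    and ratio_bound: "\<lbrakk>I \<in> instances P; ybar \<in> reference_points P I\<rbrakk> \<Longrightarrow>
      U I ybar \<le> poly \<pi> (encoding_length I) * (real (a I ybar) / real (b I ybar))"
begin

definition ratio :: "mc_instance \<Rightarrow> nat" where
  "ratio I = nat \<lceil>poly \<pi> (real (bit_size (enc_instance I)))\<rceil>"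

text \<open>
  Costs are measured in units in which the lower bound divided by \<open>m\<close> is twice the rounding error.
  If the lower bound is 0, then so is the optimal value, and the instance is left as it is.
\<close>

definition scaling :: "nat \<Rightarrow> mc_instance \<Rightarrow> nat vec \<Rightarrow> nat" where
  "scaling m I ybar = m * (2 * rounding_error (snd I)) * b I ybar"

definition rounded_instance :: "nat \<Rightarrow> mc_instance \<Rightarrow> nat vec \<Rightarrow> mc_instance" where
  "rounded_instance m I ybar =
     (if a I ybar = 0 then I else scaled_instance (scaling m I ybar) (a I ybar) I)"

definition rounded_point :: "nat \<Rightarrow> mc_instance \<Rightarrow> nat vec \<Rightarrow> nat vec" where
  "rounded_point m I ybar =
     (if a I ybar = 0 then ybar else map_vec (scale (scaling m I ybar) (a I ybar)) ybar)"

definition rounded_bound :: "nat \<Rightarrow> mc_instance \<Rightarrow> nat vec \<Rightarrow> nat" where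
  "rounded_bound m I ybar =
     ratio (rounded_instance m I ybar) * (rounding_error (snd I) * (2 * m * ratio I + 1))"

lemma U_le_ratio_mult:
  assumes "I \<in> instances P" and "ybar \<in> reference_points P I"
  shows "U I ybar \<le> real (ratio I) * (real (a I ybar) / real (b I ybar))"
proof -
  have "poly \<pi> (encoding_length I) \<le> real (ratio I)"
    unfolding ratio_def encoding_length_def by (rule real_nat_ceiling_ge)
  then show ?thesis
    using ratio_bound[OF assms] by (elim order_trans[OF _ mult_right_mono]) auto
qed

lemma U_le_ratio_mult_opt_val:
  assumes "I \<in> instances P" and "ybar \<in> reference_points P I"
  shows "U I ybar \<le> real (ratio I) * opt_val P p I ybar"
  using U_le_ratio_mult[OF assms] by (rule order_trans) (intro mult_left_mono lower_bound assms, simp)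

context
  fixes m :: nat and I :: mc_instance and ybar :: "nat vec"
  assumes m_pos: "0 < m" and inst: "I \<in> instances P" and point: "ybar \<in> reference_points P I"
begin

lemma rounded_instance_in_instances: "rounded_instance m I ybar \<in> instances P"
  using inst by (simp add: rounded_instance_def scaled_instance_in_instances)

lemma rounded_point_in_reference_points:
  "rounded_point m I ybar \<in> reference_points P (rounded_instance m I ybar)"
  using point
  by (simp add: rounded_instance_def rounded_point_def scaled_reference_point[OF problem inst])

lemma solutions_rounded_instance: "solutions P (rounded_instance m I ybar) = solutions P I"
  by (simp add: rounded_instance_def)

lemma scaling_div_eq:
  "a I ybar \<noteq> 0 \<Longrightarrow> real (scaling m I ybar) / real (a I ybar) * (real (a I ybar) / real (b I ybar))
    = real m * (2 * real (rounding_error (snd I)))"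
  using denominator_pos[OF inst point] by (simp add: scaling_def)

lemma rounded_optimum_accuracy:
  assumes solution: "x \<in> solutions P I"
    and optimal: "ref_obj p (rounded_point m I ybar) (cost (rounded_instance m I ybar) x)
      = opt_val P p (rounded_instance m I ybar) (rounded_point m I ybar)"
  shows "ref_obj p ybar (cost I x) \<le> (1 + 1 / real m) * opt_val P p I ybar"
proof (cases "a I ybar = 0")
  case True
  then have "ref_obj p ybar (cost I x) = opt_val P p I ybar"
    using optimal by (simp add: rounded_instance_def rounded_point_def)
  then show ?thesis using opt_val_nonneg[OF problem inst exponent point] by (simp add: distrib_right)
next
  case False
  let ?opt = "opt_val P p I ybar" and ?L = "real (a I ybar) / real (b I ybar)"
  let ?\<rho> = "real (scaling m I ybar) / real (a I ybar)"
  have "rounding_error (snd I) > 0" by (simp add: rounding_error_def)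
  then have \<rho>_pos: "0 < ?\<rho>" using False m_pos denominator_pos[OF inst point] by (simp add: scaling_def)
  have "?\<rho> * ref_obj p ybar (cost I x) \<le> ?\<rho> * ?opt + 2 * real (rounding_error (snd I))"
    by (rule scaled_optimum_near_optimal[OF exponent problem inst point solution])
      (use optimal False in \<open>simp add: rounded_instance_def rounded_point_def\<close>)
  also have "2 * real (rounding_error (snd I)) = ?\<rho> * ?L / real m"
    unfolding scaling_div_eq[OF False] using m_pos by simp
  also have "?\<rho> * ?opt + \<dots> = ?\<rho> * (?opt + ?L / real m)"
    by (simp only: distrib_left times_divide_eq_right)
  finally have "ref_obj p ybar (cost I x) \<le> ?opt + ?L / real m"
    using \<rho>_pos by (simp only: mult_le_cancel_left_pos)
  also have "\<dots> \<le> ?opt + ?opt / real m"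
    using lower_bound[OF inst point] by (intro add_left_mono divide_right_mono) auto
  finally show ?thesis by (simp add: algebra_simps)
qed

lemma opt_val_rounded_le:
  "opt_val P p (rounded_instance m I ybar) (rounded_point m I ybar)
    \<le> real (rounding_error (snd I) * (2 * m * ratio I + 1))"
proof -
  let ?opt = "opt_val P p I ybar" and ?L = "real (a I ybar) / real (b I ybar)"
  let ?\<rho> = "real (scaling m I ybar) / real (a I ybar)" and ?E = "real (rounding_error (snd I))"
  have opt: "?opt \<le> real (ratio I) * ?L"
    using upper_bound[OF inst point] U_le_ratio_mult[OF inst point] by (rule order_trans)
  show ?thesis
  proof (cases "a I ybar = 0")
    case True
    then have "?opt \<le> 0" using opt by simp
    then show ?thesis using True by (simp add: rounded_instance_def rounded_point_def order_trans)
  next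
    case False
    have "opt_val P p (rounded_instance m I ybar) (rounded_point m I ybar) \<le> ?\<rho> * ?opt + ?E"
      using False
        opt_val_scaled_instance[OF exponent problem inst point, of "scaling m I ybar" "a I ybar"]
      by (simp add: rounded_instance_def rounded_point_def)
    also have "?\<rho> * ?opt \<le> ?\<rho> * (real (ratio I) * ?L)" using opt by (rule mult_left_mono) simp
    also have "\<dots> = real (ratio I) * (?\<rho> * ?L)" by (simp only: mult.left_commute)
    also have "\<dots> = real (ratio I) * (real m * (2 * ?E))" by (simp only: scaling_div_eq[OF False])
    finally show ?thesis by (simp add: algebra_simps)
  qed
qed

lemma U_rounded_le:
  "U (rounded_instance m I ybar) (rounded_point m I ybar) \<le> real (rounded_bound m I ybar)"
  using U_le_ratio_mult_opt_val[OF rounded_instance_in_instances rounded_point_in_reference_points]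
    mult_left_mono[OF opt_val_rounded_le, of "real (ratio (rounded_instance m I ybar))"]
  unfolding rounded_bound_def of_nat_mult[of "ratio _"] by linarith

lemma U_rounded_nonneg: "0 \<le> U (rounded_instance m I ybar) (rounded_point m I ybar)"
  using opt_val_nonneg[OF problem rounded_instance_in_instances exponent
      rounded_point_in_reference_points]
    upper_bound[OF rounded_instance_in_instances rounded_point_in_reference_points]
  by (rule order_trans)

end

lemma poly_time_rounded_input:
  assumes input: "poly_time S u f (\<lambda>i. enc_input (I i) (ybar i))"
    and m: "poly_time S u f (\<lambda>i. Num (m i))"
    and a: "poly_time S u f (\<lambda>i. Num (a (I i) (ybar i)))"
    and b: "poly_time S u f (\<lambda>i. Num (b (I i) (ybar i)))"
    and inst: "\<And>i. i \<in> S \<Longrightarrow> I i \<in> instances P"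
  shows "poly_time S u f
    (\<lambda>i. enc_input (rounded_instance (m i) (I i) (ybar i)) (rounded_point (m i) (I i) (ybar i)))"
proof (rule poly_time_If[OF a])
  let ?K = "\<lambda>i. scaling (m i) (I i) (ybar i)" and ?a = "\<lambda>i. a (I i) (ybar i)"
  let ?rounded = "\<lambda>i. enc_input
    (rounded_instance (m i) (I i) (ybar i)) (rounded_point (m i) (I i) (ybar i))"
  have "poly_time S u f (\<lambda>i. enc_mat (snd (I i)))"
    by (rule poly_time_snd[OF poly_time_fst[OF input[unfolded enc_input_def enc_instance_def]]])
  then have "poly_time S u f (\<lambda>i. Num (rounding_error (snd (I i))))"
    by (rule poly_time_rounding_error) (rule dim_row_pos[OF problem inst])
  then have K: "poly_time S u f (\<lambda>i. Num (?K i))"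
    unfolding scaling_def
    by (intro poly_time_mult poly_time_const poly_time_bit_size_input[OF m] m b)
  let ?S1 = "{i \<in> S. Num (?a i) \<noteq> Num 0}" and ?S0 = "{i \<in> S. Num (?a i) = Num 0}"
  have "poly_time S u f (\<lambda>i. enc_input
      (scaled_instance (?K i) (?a i) (I i)) (map_vec (scale (?K i) (?a i)) (ybar i)))"
    using input K a by (rule poly_time_scaled_input)
  then have "poly_time ?S1 u f (\<lambda>i. enc_input
      (scaled_instance (?K i) (?a i) (I i)) (map_vec (scale (?K i) (?a i)) (ybar i)))"
    by (rule poly_time_subset) blast
  then show "poly_time ?S1 u f ?rounded"
    by (rule poly_time_cong) (auto simp: rounded_instance_def rounded_point_def)
  have "poly_time ?S0 u f (\<lambda>i. enc_input (I i) (ybar i))"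
    using input by (rule poly_time_subset) blast
  then show "poly_time ?S0 u f ?rounded"
    by (rule poly_time_cong) (auto simp: rounded_instance_def rounded_point_def)
qed

lemma poly_time_round_task:
  assumes "poly_time_fraction P a b"
  shows "poly_time (tasks P) task_size enc_task
    (\<lambda>(m, I, ybar). enc_input (rounded_instance m I ybar) (rounded_point m I ybar))"
proof -
  let ?m = "\<lambda>t. fst t" and ?I = "\<lambda>t. fst (snd t)" and ?y = "\<lambda>t. snd (snd t)"
  have task: "poly_time (tasks P) task_size enc_task (\<lambda>t. Pair (Num (?m t)) (enc_input (?I t) (?y t)))"
    using poly_time_refl[OF poly_bounded_enc_task[OF problem]]
    by (simp add: enc_task_def case_prod_unfold)
  note m = poly_time_fst[OF task] and input = poly_time_snd[OF task]
  have "poly_time (tasks P) (\<lambda>t. bit_size (enc_instance (?I t))) (\<lambda>t. enc_input (?I t) (?y t))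
      (\<lambda>t. Pair (Num (a (?I t) (?y t))) (Num (b (?I t) (?y t))))"
    using poly_time_reindex[OF assms[unfolded poly_time_fraction_def], of snd "tasks P"]
    by (force simp: tasks_def case_prod_unfold)
  then have "poly_time (tasks P) task_size (\<lambda>t. enc_input (?I t) (?y t))
      (\<lambda>t. Pair (Num (a (?I t) (?y t))) (Num (b (?I t) (?y t))))"
    by (rule poly_time_size_mono) (simp add: poly_bounded_le task_size_def case_prod_unfold)
  with input have bound: "poly_time (tasks P) task_size enc_task
      (\<lambda>t. Pair (Num (a (?I t) (?y t))) (Num (b (?I t) (?y t))))"
    by (rule poly_time_trans)
  have "?I t \<in> instances P" if "t \<in> tasks P" for t using that by (cases t) simp
  with input m poly_time_fst[OF bound] poly_time_snd[OF bound] show ?thesis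
    unfolding case_prod_unfold by (rule poly_time_rounded_input)
qed

lemma poly_bounded_ratio:
  "poly_bounded S u (\<lambda>i. bit_size (enc_instance (I i))) \<Longrightarrow> poly_bounded S u (\<lambda>i. ratio (I i))"
  unfolding ratio_def by (rule poly_bounded_poly)

lemma poly_bounded_rounded_bound:
  assumes "poly_bounded (tasks P) task_size
    (\<lambda>(m, I, ybar). bit_size (enc_instance (rounded_instance m I ybar)))"
  shows "poly_bounded (tasks P) task_size (\<lambda>(m, I, ybar). rounded_bound m I ybar)"
proof -
  let ?m = "\<lambda>t. fst t" and ?I = "\<lambda>t. fst (snd t)" and ?y = "\<lambda>t. snd (snd t)"
  have m: "poly_bounded (tasks P) task_size ?m"
    and len: "poly_bounded (tasks P) task_size (\<lambda>t. bit_size (enc_instance (?I t)))"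
    by (rule poly_bounded_le, simp add: task_size_def case_prod_unfold)+
  have "poly_bounded (tasks P) task_size (\<lambda>t. bit_size (enc_mat (snd (?I t))))"
    using len by (rule poly_bounded_mono) (simp add: enc_instance_def)
  then have "poly_bounded (tasks P) task_size (\<lambda>t. rounding_error (snd (?I t)))"
    by (rule poly_bounded_rounding_error) (rule dim_row_pos[OF problem], auto simp: tasks_def inputs_def)
  then show ?thesis
    unfolding rounded_bound_def case_prod_unfold
    by (intro poly_bounded_intros poly_bounded_ratio m len assms[unfolded case_prod_unfold])
qed

lemma poly_bounded_exact_time:
  assumes "poly_time_fraction P a b"
  shows "poly_bounded (tasks P) task_size (\<lambda>(m, I, ybar).
    nat \<lceil>poly2 q (real (bit_size (enc_instance (rounded_instance m I ybar))))
      (real (rounded_bound m I ybar))\<rceil>)"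
proof -
  have len: "poly_bounded (tasks P) task_size
      (\<lambda>(m, I, ybar). bit_size (enc_instance (rounded_instance m I ybar)))"
    using poly_time_bit_size_output[OF poly_time_round_task[OF assms]]
    by (rule poly_bounded_mono) (auto simp: enc_input_def)
  show ?thesis
    using poly_bounded_poly2[OF len poly_bounded_rounded_bound[OF len]]
    by (simp add: case_prod_unfold)
qed

lemma has_fptas_if_exact_algorithm:
  assumes fraction: "poly_time_fraction P a b"
    and mono: "nondecreasing2 q"
    and exact: "\<exists>A. \<forall>I\<in>instances P. \<forall>ybar\<in>reference_points P I.
      \<exists>x\<in>solutions P I. ref_obj p ybar (cost I x) = opt_val P p I ybar \<and>
        runs_within A (enc_input I ybar) (enc_vec x) (poly2 q (encoding_length I) (U I ybar))"
  shows "has_fptas P p"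
proof -
  define I' where "I' = (\<lambda>(m, I, ybar). rounded_instance m I ybar)"
  define y' where "y' = (\<lambda>(m, I, ybar). rounded_point m I ybar)"
  define u' where "u' = (\<lambda>(m, I, ybar). rounded_bound m I ybar)"
  let ?len = "\<lambda>t. bit_size (enc_instance (I' t))"
  let ?time = "\<lambda>t. nat \<lceil>poly2 q (real (?len t)) (real (u' t))\<rceil>"
  let ?optimal = "\<lambda>t x. x \<in> solutions P (I' t) \<and>
    ref_obj p (y' t) (cost (I' t) x) = opt_val P p (I' t) (y' t)"
  have rounding: "poly_time (tasks P) task_size enc_task (\<lambda>t. enc_input (I' t) (y' t))"
    using poly_time_round_task[OF fraction] by (simp add: I'_def y'_def case_prod_unfold)
  have time: "poly_bounded (tasks P) task_size ?time"
    using poly_bounded_exact_time[OF fraction] by (simp add: I'_def u'_def case_prod_unfold)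
  obtain A where run_A: "\<And>I ybar. I \<in> instances P \<Longrightarrow> ybar \<in> reference_points P I \<Longrightarrow>
      \<exists>x\<in>solutions P I. ref_obj p ybar (cost I x) = opt_val P p I ybar \<and>
        runs_within A (enc_input I ybar) (enc_vec x) (poly2 q (encoding_length I) (U I ybar))"
    using exact by blast
  obtain X where X_optimal: "\<And>t. t \<in> tasks P \<Longrightarrow> ?optimal t (X t)"
    and solving: "poly_time (tasks P) task_size (\<lambda>t. enc_input (I' t) (y' t)) (\<lambda>t. enc_vec (X t))"
  proof (rule runs_within_poly_timeE[OF time])
    fix t assume "t \<in> tasks P"
    then have I': "I' t \<in> instances P" and y': "y' t \<in> reference_points P (I' t)"
      and U': "0 \<le> U (I' t) (y' t)" "U (I' t) (y' t) \<le> real (u' t)"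
      by (auto simp: I'_def y'_def u'_def tasks_def inputs_def rounded_instance_in_instances
          rounded_point_in_reference_points U_rounded_nonneg U_rounded_le)
    have "poly2 q (encoding_length (I' t)) (U (I' t) (y' t)) \<le> poly2 q (real (?len t)) (real (u' t))"
      using mono U' unfolding nondecreasing2_def encoding_length_def by simp
    also have "\<dots> \<le> real (?time t)" by (rule real_nat_ceiling_ge)
    finally show "\<exists>x. ?optimal t x \<and>
        runs_within A (enc_input (I' t) (y' t)) (enc_vec x) (real (?time t))"
      using run_A[OF I' y'] runs_within_mono by blast
  qed blast
  show ?thesis
    by (rule has_fptasI[OF problem exponent poly_time_trans[OF rounding solving]])
      (use X_optimal in \<open>fastforce simp: I'_def y'_def solutions_rounded_instance
        intro: rounded_optimum_accuracy\<close>)+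
qed

end

theorem theorem15:
  fixes P :: mc_problem
    and p :: ereal
    and L U :: "mc_instance \<Rightarrow> nat vec \<Rightarrow> real"
    and \<pi>\<^sub>1 \<pi>\<^sub>2 :: "real poly"
    and \<pi>\<^sub>3 :: "real poly poly"
  assumes "multicriteria_problem P"
    and "1 \<le> p"
    and "nondecreasing \<pi>\<^sub>1" and "nondecreasing \<pi>\<^sub>2" and "nondecreasing2 \<pi>\<^sub>3"
    and bounds: "\<And>I ybar. I \<in> instances P \<Longrightarrow> ybar \<in> reference_points P I \<Longrightarrow>
      L I ybar \<le> opt_val P p I ybar \<and> opt_val P p I ybar \<le> U I ybar \<and>
      U I ybar \<le> poly \<pi>\<^sub>2 (encoding_length I) * L I ybar"
    and bounds_algorithm: "\<exists>A. \<forall>I\<in>instances P. \<forall>ybar\<in>reference_points P I.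
      \<exists>l u. represents l (L I ybar) \<and> represents u (U I ybar) \<and>
        runs_within A (enc_input I ybar) (Pair l u) (poly \<pi>\<^sub>1 (encoding_length I))"
    and exact_algorithm: "\<exists>A. \<forall>I\<in>instances P. \<forall>ybar\<in>reference_points P I.
      \<exists>x\<in>solutions P I. ref_obj p ybar (cost I x) = opt_val P p I ybar \<and>
        runs_within A (enc_input I ybar) (enc_vec x)
          (poly2 \<pi>\<^sub>3 (encoding_length I) (U I ybar))"
  shows "has_fptas P p"
proof -
  obtain a b where fraction: "\<And>I ybar. I \<in> instances P \<Longrightarrow> ybar \<in> reference_points P I \<Longrightarrow>
      0 < b I ybar \<and> L I ybar = real (a I ybar) / real (b I ybar)"
    and time: "poly_time_fraction P a b"
    using bounds_algorithm by (rule poly_time_lower_bound_fractionE) blast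
  interpret bracketed_mc_problem P p a b U \<pi>\<^sub>2
    using assms(1,2) fraction bounds by unfold_locales auto
  show ?thesis
    using time assms(5) exact_algorithm by (rule has_fptas_if_exact_algorithm)
qed

end
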